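(* Let $q$ be a prime power, $k\geqslant 3$, let $G$ be an arc of $\mathrm{V}_k(\mathbb{F}_q)$ whose elements are ordered, and let $n$ be an integer with $0\leqslant n\leqslant |G|-k$. Suppose $(G,n)$ has Property W. Then the co-secants to $S$ containing only points of $G$ are determined by $G$, for any arc $S$ of size $q+2k+n-1-|G|$ containing $G$: that is, if $S$ and $S'$ are arcs of $\mathrm{V}_k(\mathbb{F}_q)$ of size $q+2k+n-1-|G|$ both containing $G$, then the set of hyperplanes $H$ with $|H\cap S|=k-2$ and $H\cap S\subseteq G$ equals the set of hyperplanes $H$ with $|H\cap S'|=k-2$ and $H\cap S'\subseteq G$.
   Context: $\mathrm{V}_k(\mathbb{F}_q)$ is the $k$-dimensional vector space over $\mathbb{F}_q$. An arc is a set of vectors of $\mathrm{V}_k(\mathbb{F}_q)$ in which every subset of size $k$ is a basis. A co-secant to an arc $S$ is a hyperplane containing precisely $k-2$ vectors of $S$. $\det(v_1,\ldots,v_k)$ is the determinant of the matrix with rows $v_i$ w.r.t. a fixed basis; subsets of $G$ inherit its order and for ordered $C=\{p_1,\ldots,p_{k-1}\}$, $\det(u,C)=\det(u,p_1,\ldots,p_{k-1})$. The matrix $\mathrm{M}_n$ has rows indexed by subsets $C$ of $G$ of size $k-1$ and columns indexed by pairs $(A,E)$ with $E\subseteq G$, $|E|=|G|-n$, $A\subseteq E$, $|A|=k-2$; its $(C,(A,E))$ entry is $\prod_{u\in G\setminus E}\det(u,C)$ if $A\subset C$ and $0$ otherwise. $(G,n)$ has Property W if for each subset $A$ of $G$ of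 size $k-2$ there exist subsets $C,C_1,\ldots,C_{|G|-n-k+1}$ of $G$ of size $k-1$ containing $A$ such that, for each $i=1,\ldots,|G|-n-k+1$, the column space of $\mathrm{M}_n$ contains a vector whose non-zero coordinates are exactly at $C$ and $C_i$. *)

theory Defs
  imports "Jordan_Normal_Form.VS_Connect" "Jordan_Normal_Form.Determinant"
begin

definition arc :: "nat \<Rightarrow> 'a::field vec set \<Rightarrow> bool" where
  "arc k S \<longleftrightarrow> S \<subseteq> carrier_vec k \<and>
     (\<forall>B \<subseteq> S. card B = k \<longrightarrow> vectorspace.basis class_ring (module_vec TYPE('a) k) B)"

definition hyperplane :: "nat \<Rightarrow> 'a::field vec set \<Rightarrow> bool" where
  "hyperplane k H \<longleftrightarrow> subspace class_ring H (module_vec TYPE('a) k) \<and>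
     vectorspace.dim class_ring (vectorspace.vs (module_vec TYPE('a) k) H) = k - 1"

definition cosecant :: "nat \<Rightarrow> 'a::field vec set \<Rightarrow> 'a vec set \<Rightarrow> bool" where
  "cosecant k S H \<longleftrightarrow> hyperplane k H \<and> card (H \<inter> S) = k - 2"

text \<open>
  A finite ordered set is represented by the distinct list of its elements in increasing
  order. Its subsets, with the inherited order, are then the sublists: if \<open>xs\<close> is distinct,
  \<^const>\<open>set\<close> is a bijection from the members of \<open>sublists_of_size m xs\<close> to the
  \<open>m\<close>-element subsets of \<open>set xs\<close>.
\<close>

definition sublists_of_size :: "nat \<Rightarrow> 'b list \<Rightarrow> 'b list list" where
  "sublists_of_size m xs = filter (\<lambda>ys. length ys = m) (subseqs xs)"

definition det_rows :: "nat \<Rightarrow> 'a::field vec list \<Rightarrow> 'a" where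
  "det_rows k vs = det (mat_of_rows k vs)"

definition M_rows :: "nat \<Rightarrow> 'a::field vec list \<Rightarrow> 'a vec list list" where
  "M_rows k G = sublists_of_size (k - 1) G"

definition M_cols :: "nat \<Rightarrow> 'a::field vec list \<Rightarrow> nat \<Rightarrow> ('a vec list \<times> 'a vec list) list" where
  "M_cols k G n =
     [(A, E). E \<leftarrow> sublists_of_size (length G - n) G, A \<leftarrow> sublists_of_size (k - 2) E]"

definition M_entry ::
  "nat \<Rightarrow> 'a::field vec list \<Rightarrow> 'a vec list \<Rightarrow> 'a vec list \<times> 'a vec list \<Rightarrow> 'a" where
  "M_entry k G C = (\<lambda>(A, E).
     if set A \<subset> set C then \<Prod>u \<in> set G - set E. det_rows k (u # C) else 0)"

definition M_mat :: "nat \<Rightarrow> 'a::field vec list \<Rightarrow> nat \<Rightarrow> 'a mat" where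
  "M_mat k G n = mat (length (M_rows k G)) (length (M_cols k G n))
     (\<lambda>(i, j). M_entry k G (M_rows k G ! i) (M_cols k G n ! j))"

definition M_column_space :: "nat \<Rightarrow> 'a::field vec list \<Rightarrow> nat \<Rightarrow> 'a vec set" where
  "M_column_space k G n = vec_space.col_space (length (M_rows k G)) (M_mat k G n)"

text \<open>The row labels at which a vector indexed by the rows of \<open>M_mat k G n\<close> is non-zero.\<close>

definition M_support :: "nat \<Rightarrow> 'a::field vec list \<Rightarrow> 'a vec \<Rightarrow> 'a vec list set" where
  "M_support k G w = {M_rows k G ! i | i. i < length (M_rows k G) \<and> w $ i \<noteq> 0}"

text \<open>
  The sets \<open>C, C\<^sub>1, \<dots>, C\<^sub>m\<close> are required to be pairwise distinct. In particular each witness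
  vector has exactly two non-zero coordinates.
\<close>

definition property_W :: "nat \<Rightarrow> 'a::field vec list \<Rightarrow> nat \<Rightarrow> bool" where
  "property_W k G n \<longleftrightarrow>
     (\<forall>A \<in> set (sublists_of_size (k - 2) G).
        \<exists>C Cs. let I = {1..length G - n - k + 1} in
          C \<in> set (M_rows k G) \<and> set A \<subseteq> set C \<and>
          (\<forall>i \<in> I. Cs i \<in> set (M_rows k G) \<and> set A \<subseteq> set (Cs i) \<and> Cs i \<noteq> C) \<and>
          inj_on Cs I \<and>
          (\<forall>i \<in> I. \<exists>w \<in> M_column_space k G n. M_support k G w = {C, Cs i}))"

end

theory Submission
  imports Defs "Jordan_Normal_Form.DL_Rank"
begin

text \<open>
  Fix a \<open>(k - 2)\<close>-subset \<open>A\<close> of \<open>G\<close>. Modulo the span of \<open>A\<close> the space is a plane, in which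
  \<open>det (u, v, A)\<close> becomes the cross product of coordinate pairs, and the points of \<open>S - A\<close> become
  \<open>q + 1 - t\<close> points of the projective line, where \<open>t = card G - n - k\<close>. The \<open>t\<close> missing points are
  the hyperplanes meeting \<open>S\<close> exactly in \<open>A\<close>; the product \<open>f\<close> of their linear forms is the tangent
  function of \<open>S\<close> at \<open>A\<close>. The product of \<open>cross u e\<close> over all other points \<open>u\<close> of the line does not
  depend on the point \<open>e\<close>, so \<open>f e\<close> is, up to a constant, the inverse of the product of
  \<open>det (u, e, A)\<close> over \<open>u\<close> in \<open>S - A - {e}\<close>. Up to sign that product depends only on
  \<open>C = A \<union> {e}\<close>. This replaces Segre's lemma of tangents: interpolation of \<open>f\<close>
  says that the inverses of the weights \<open>row_weight k S C * row_weight k G C\<close> form a vector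
  in the left kernel of \<open>M\<close>. A vector of the column space with support \<open>{C, C\<^sub>i}\<close> then gives the
  ratio of the weights at \<open>C\<close> and \<open>C\<^sub>i\<close> in terms of \<open>G\<close> alone. Property W supplies \<open>t + 1\<close> values of
  \<open>f\<close> up to a common factor, and these determine the form \<open>f\<close> of degree \<open>t\<close>, hence its zeros.
\<close>

section \<open>Points of the projective line\<close>

text \<open>A non-zero pair stands for a point of the projective line; two of them stand for the
  same point exactly when \<open>cross\<close> vanishes. For fixed \<open>u\<close> it is a linear
  form with zero \<open>u\<close>.\<close>

definition cross :: "'a::field \<times> 'a \<Rightarrow> 'a \<times> 'a \<Rightarrow> 'a" where
  "cross u v = fst u * snd v - fst v * snd u"

lemma cross_self [simp]: "cross u u = 0"
  by (simp add: cross_def)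

lemma cross_commute: "cross v u = - cross u v"
  by (simp add: cross_def)

lemma cross_eq_0_commute: "cross v u = 0 \<longleftrightarrow> cross u v = 0"
  by (simp add: cross_commute[of v u])

lemma cross_plucker: "cross a b * cross w x = cross w b * cross a x - cross w a * cross b x"
  by (simp add: cross_def algebra_simps)

text \<open>Representatives of distinct projective points. The non-zero condition is separate
  because the pairwise one says nothing about a singleton.\<close>

definition general_position :: "('a::field \<times> 'a) set \<Rightarrow> bool" where
  "general_position R \<longleftrightarrow> (\<forall>u\<in>R. u \<noteq> (0, 0)) \<and> pairwise (\<lambda>u v. cross u v \<noteq> 0) R"

lemma general_positionD: "general_position R \<Longrightarrow> u \<in> R \<Longrightarrow> v \<in> R \<Longrightarrow> u \<noteq> v \<Longrightarrow> cross u v \<noteq> 0"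
  by (auto simp: general_position_def pairwise_def)

lemma general_position_nonzero: "general_position R \<Longrightarrow> u \<in> R \<Longrightarrow> u \<noteq> (0, 0)"
  by (auto simp: general_position_def)

lemma general_position_subset: "general_position R \<Longrightarrow> R' \<subseteq> R \<Longrightarrow> general_position R'"
  unfolding general_position_def by (meson pairwise_subset subsetD)

lemma cross_eq_0_trans:
  assumes "w \<noteq> (0, 0)" "cross u w = 0" "cross w v = 0"
  shows "cross u v = 0"
proof -
  have "fst w * cross u v = fst u * cross w v + fst v * cross u w"
    "snd w * cross u v = snd u * cross w v + snd v * cross u w"
    by (simp_all add: cross_def algebra_simps)
  then have "fst w * cross u v = 0" "snd w * cross u v = 0"
    using assms(2,3) by simp_all
  then show ?thesis
    using assms(1) by (cases w) auto
qed

text \<open>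
  Induction on the number of linear forms: by the Pluecker relation each form is a combination
  of \<open>cross a _\<close> and \<open>cross b _\<close> for two nodes \<open>a\<close>, \<open>b\<close>, and the form \<open>cross a _\<close> cancels the node \<open>a\<close>.
\<close>

lemma interpolation_identity:
  assumes "finite W" "finite E" "card E = card W + 2" "general_position E"
  shows "(\<Sum>e\<in>E. (\<Prod>w\<in>W. cross w e) / (\<Prod>u\<in>E - {e}. cross u e)) = 0"
  using assms
proof (induction W arbitrary: E rule: finite_induct)
  case empty
  then obtain a b where E: "E = {a, b}" "a \<noteq> b"
    by (metis card_2_iff add_0 card.empty)
  have "E - {a} = {b}" "E - {b} = {a}"
    using E by auto
  then show ?case
    using E cross_commute[of a b] by simp
next
  case (insert w W)
  have "\<exists>a\<in>E. \<exists>b\<in>E. a \<noteq> b"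
    using insert.prems by (metis Suc_1 card_le_Suc0_iff_eq le_add2 not_less_eq_eq One_nat_def)
  then obtain a b where ab: "a \<in> E" "b \<in> E" "a \<noteq> b"
    by blast
  have nz: "cross a b \<noteq> 0"
    using ab general_positionD insert.prems(3) by blast
  let ?f = "\<lambda>e. \<Prod>w\<in>W. cross w e"
  \<comment> \<open>The term at \<open>e = c\<close> vanishes because \<open>cross c c = 0\<close>;
    elsewhere \<open>cross c e\<close> cancels, which leaves the identity for \<open>W\<close> and
    the nodes \<open>E - {c}\<close>.\<close>
  have node: "(\<Sum>e\<in>E. cross c e * ?f e / (\<Prod>u\<in>E - {e}. cross u e)) = 0" if c: "c \<in> E" for c
  proof -
    have "(\<Sum>e\<in>E. cross c e * ?f e / (\<Prod>u\<in>E - {e}. cross u e))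
        = (\<Sum>e\<in>E - {c}. cross c e * ?f e / (\<Prod>u\<in>E - {e}. cross u e))"
      using c insert.prems(1) by (simp add: sum.remove[of E c])
    also have "\<dots> = (\<Sum>e\<in>E - {c}. ?f e / (\<Prod>u\<in>E - {c} - {e}. cross u e))"
    proof (rule sum.cong[OF refl])
      fix e assume e: "e \<in> E - {c}"
      have "E - {e} - {c} = E - {c} - {e}"
        by auto
      then have "(\<Prod>u\<in>E - {e}. cross u e) = cross c e * (\<Prod>u\<in>E - {c} - {e}. cross u e)"
        using e c insert.prems(1) by (subst prod.remove[of _ c]) auto
      moreover have "cross c e \<noteq> 0"
        using e c general_positionD insert.prems(3) by blast
      ultimately show "cross c e * ?f e / (\<Prod>u\<in>E - {e}. cross u e)
          = ?f e / (\<Prod>u\<in>E - {c} - {e}. cross u e)"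
        by simp
    qed
    also have "\<dots> = 0"
    proof (rule insert.IH)
      show "general_position (E - {c})"
        using insert.prems(3) by (rule general_position_subset) blast
    qed (use insert.prems insert.hyps c in auto)
    finally show ?thesis .
  qed
  have "cross a b * (\<Sum>e\<in>E. (\<Prod>w\<in>insert w W. cross w e) / (\<Prod>u\<in>E - {e}. cross u e))
     = (\<Sum>e\<in>E. cross w b * (cross a e * ?f e / (\<Prod>u\<in>E - {e}. cross u e))
              - cross w a * (cross b e * ?f e / (\<Prod>u\<in>E - {e}. cross u e)))"
    unfolding sum_distrib_left
  proof (rule sum.cong[OF refl])
    fix e
    have "cross a b * ((\<Prod>w\<in>insert w W. cross w e) / (\<Prod>u\<in>E - {e}. cross u e))
      = (cross a b * cross w e) * (?f e / (\<Prod>u\<in>E - {e}. cross u e))"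
      using insert.hyps by simp
    then show "cross a b * ((\<Prod>w\<in>insert w W. cross w e) / (\<Prod>u\<in>E - {e}. cross u e))
      = cross w b * (cross a e * ?f e / (\<Prod>u\<in>E - {e}. cross u e))
        - cross w a * (cross b e * ?f e / (\<Prod>u\<in>E - {e}. cross u e))"
      unfolding cross_plucker[of a b w e] by (simp only: left_diff_distrib times_divide_eq_right mult.assoc diff_divide_distrib)
  qed
  also have "\<dots> = 0"
    unfolding sum_subtractf sum_distrib_left[symmetric] node[OF ab(1)] node[OF ab(2)] by simp
  finally show ?case
    using nz by simp
qed

section \<open>Counting points of the line over a finite field\<close>

lemma inj_on_cross_ratio:
  assumes R: "general_position R" and ew: "cross e w \<noteq> 0"
    and w: "\<forall>u\<in>R. cross u w \<noteq> 0"
  shows "inj_on (\<lambda>u. cross u e / cross u w) R"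
proof (rule inj_onI, rule ccontr)
  fix u v assume uv: "u \<in> R" "v \<in> R" "u \<noteq> v" and eq: "cross u e / cross u w = cross v e / cross v w"
  then have "cross u e * cross v w - cross v e * cross u w = 0"
    using w by (simp add: field_simps)
  \<comment> \<open>The Pluecker relation: equal ratios force \<open>u\<close> and \<open>v\<close>
    to be the same projective point.\<close>
  moreover have "cross u e * cross v w - cross v e * cross u w = cross u v * cross e w"
    by (simp add: cross_def algebra_simps)
  ultimately show False
    using ew general_positionD[OF R uv] by simp
qed

text \<open>If \<open>w\<close> were none of the points of \<open>R\<close>, the ratio taken with a
  fixed \<open>e\<close> in \<open>R\<close> would embed \<open>R\<close> into a field with one
  element fewer.\<close>

lemma general_position_covers:
  fixes R :: "('a::{field,finite} \<times> 'a) set"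
  assumes R: "general_position R" and card: "card R = card (UNIV :: 'a set) + 1"
  shows "\<exists>u\<in>R. cross u w = 0"
proof (rule ccontr)
  assume "\<not> ?thesis"
  then have w: "\<forall>u\<in>R. cross u w \<noteq> 0"
    by blast
  obtain e where e: "e \<in> R"
    using card by (cases "R = {}") auto
  have "inj_on (\<lambda>u. cross u e / cross u w) R"
    by (rule inj_on_cross_ratio[OF R _ w]) (use e w in blast)
  then have "card R \<le> card (UNIV :: 'a set)"
    by (metis card_inj_on_le finite_class.finite_UNIV subset_UNIV)
  then show False
    using card by simp
qed

text \<open>The elements pair off with their inverses; the induction removes one such pair at a
  time.\<close>

lemma prod_inverse_closed:
  fixes U :: "'a::field set"
  assumes "finite U" "0 \<notin> U" "\<And>x. x \<in> U \<Longrightarrow> inverse x \<in> U \<and> inverse x \<noteq> x"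
  shows "\<Prod>U = 1"
  using assms
proof (induction "card U" arbitrary: U rule: less_induct)
  case less
  show ?case
  proof (cases "U = {}")
    case False
    then obtain x where x: "x \<in> U"
      by blast
    let ?V = "U - {x} - {inverse x}"
    have x': "inverse x \<in> U - {x}" "x \<noteq> 0"
      using less.prems(2,3) x by auto
    have "\<Prod>?V = 1"
    proof (rule less.hyps)
      show "card ?V < card U"
        using less.prems(1) x by (intro psubset_card_mono) auto
      show "inverse y \<in> ?V \<and> inverse y \<noteq> y" if "y \<in> ?V" for y
      proof -
        have "inverse y \<noteq> x"
          using that by auto
        moreover have "inverse y \<noteq> inverse x"
          using that by auto
        ultimately show ?thesis
          using that less.prems(3)[of y] by auto
      qed
    qed (use less.prems in auto)
    then show ?thesis
      using prod.remove[OF less.prems(1) x, of "\<lambda>x. x"]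
        prod.remove[OF _ x'(1), of "\<lambda>x. x"] less.prems(1) x'(2) by simp
  qed simp
qed

text \<open>Wilson's theorem for finite fields: only \<open>1\<close> and \<open>-1\<close>, which
  coincide in characteristic two, equal their inverses; the other units cancel in pairs.\<close>

lemma prod_units_eq_minus_1: "\<Prod>(UNIV - {0}) = (-1 :: 'a::{field,finite})"
proof -
  let ?U = "UNIV - {0, 1, -1} :: 'a set"
  have U: "\<Prod>?U = 1"
  proof (rule prod_inverse_closed)
    fix x assume x: "x \<in> ?U"
    have "x * x \<noteq> 1"
      using x by (simp add: square_eq_1_iff)
    then have "inverse x \<noteq> x"
      using x right_inverse[of x] by force
    moreover have "inverse x \<noteq> -1"
    proof
      assume "inverse x = -1"
      then have "inverse (inverse x) = -1"
        by simp
      then show False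
        using x by simp
    qed
    ultimately show "inverse x \<in> ?U \<and> inverse x \<noteq> x"
      using x by simp
  qed auto
  show ?thesis
  proof (cases "(1::'a) = -1")
    case True
    then have "UNIV - {0} = insert 1 ?U"
      by auto
    then have "\<Prod>(UNIV - {0}) = \<Prod>(insert 1 ?U)"
      by (rule arg_cong)
    then show ?thesis
      using U True by simp
  next
    case False
    have "UNIV - {0} = insert 1 (insert (-1) ?U)"
      by auto
    then have "\<Prod>(UNIV - {0}) = \<Prod>(insert 1 (insert (-1) ?U))"
      by (rule arg_cong)
    then show ?thesis
      using U False by simp
  qed
qed

text \<open>
  For distinct nodes \<open>e\<close>, \<open>e'\<close> the ratios \<open>cross u e / cross u e'\<close> over the other nodes run
  through all units of the field, whose product is \<open>-1\<close>.
\<close>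

lemma prod_cross_independent:
  fixes R :: "('a::{field,finite} \<times> 'a) set"
  assumes R: "general_position R" and card: "card R = card (UNIV :: 'a set) + 1"
    and e: "e \<in> R" and e': "e' \<in> R"
  shows "(\<Prod>u\<in>R - {e}. cross u e) = (\<Prod>u\<in>R - {e'}. cross u e')"
proof (cases "e = e'")
  case False
  let ?Q = "R - {e, e'}"
  let ?r = "\<lambda>u. cross u e / cross u e'"
  have fin: "finite R"
    using card card.infinite by fastforce
  have nz: "cross u e \<noteq> 0" "cross u e' \<noteq> 0" if "u \<in> ?Q" for u
    using that general_positionD[OF R] e e' by auto
  have ee: "cross e e' \<noteq> 0"
    using general_positionD[OF R e e' False] .
  have Q: "general_position ?Q"
    using R by (rule general_position_subset) blast
  have inj: "inj_on ?r ?Q"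
    by (rule inj_on_cross_ratio[OF Q ee]) (use nz in blast)
  have "?r ` ?Q = UNIV - {0}"
  proof (rule card_subset_eq)
    show "?r ` ?Q \<subseteq> UNIV - {0}"
      using nz by auto
    show "card (?r ` ?Q) = card (UNIV - {0} :: 'a set)"
      using card fin e e' False by (simp add: card_image[OF inj] card_Diff_subset)
  qed simp
  then have "(\<Prod>u\<in>?Q. ?r u) = -1"
    using prod.reindex[OF inj, of "\<lambda>x. x"] prod_units_eq_minus_1[where ?'a = 'a] by simp
  moreover have "(\<Prod>u\<in>?Q. cross u e') \<noteq> 0"
    using nz fin by auto
  ultimately have "(\<Prod>u\<in>?Q. cross u e) = - (\<Prod>u\<in>?Q. cross u e')"
    by (simp add: prod_dividef divide_eq_eq)
  \<comment> \<open>The leftover factors \<open>cross e' e\<close> and \<open>cross e e'\<close>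
    differ by a sign, which absorbs the \<open>-1\<close> from the product of the units.\<close>
  moreover have "(\<Prod>u\<in>R - {e}. cross u e) = cross e' e * (\<Prod>u\<in>?Q. cross u e)"
    using fin e' False by (subst prod.remove[of _ e']) (auto simp: Diff_insert2[symmetric])
  moreover have "(\<Prod>u\<in>R - {e'}. cross u e') = cross e e' * (\<Prod>u\<in>?Q. cross u e')"
    using fin e False by (subst prod.remove[of _ e]) (auto simp: Diff_insert2[symmetric] insert_commute)
  ultimately show ?thesis
    using cross_commute[of e' e] by simp
qed simp

section \<open>Missing points and tangent functions\<close>

lemma general_position_extend:
  fixes T :: "('a::{field,finite} \<times> 'a) set"
  assumes "general_position T" "finite T" "card T + t = card (UNIV :: 'a set) + 1"
  shows "\<exists>W. finite W \<and> card W = t \<and> T \<inter> W = {} \<and> general_position (T \<union> W)"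
  using assms
proof (induction t arbitrary: T)
  case 0
  then show ?case
    by (intro exI[of _ "{}"]) simp
next
  case (Suc t)
  \<comment> \<open>Representatives of all \<open>q + 1\<close> points of the line. \<open>T\<close>
    has fewer points, so one of them differs from every point of \<open>T\<close> and can be
    added.\<close>
  let ?P = "insert (0, 1) ((\<lambda>c. (1, c)) ` UNIV) :: ('a \<times> 'a) set"
  have P: "general_position ?P"
    by (auto simp: general_position_def pairwise_def cross_def)
  have inj: "inj (\<lambda>c::'a. (1 :: 'a, c))"
    by (auto intro: injI)
  have card_P: "card ?P = card (UNIV :: 'a set) + 1"
    by (subst card_insert_disjoint) (auto simp: card_image[OF inj])
  have "\<exists>w\<in>?P. \<forall>u\<in>T. cross u w \<noteq> 0"
  proof (rule ccontr)
    assume "\<not> ?thesis"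
    then have "\<forall>w\<in>?P. \<exists>u. u \<in> T \<and> cross u w = 0"
      by blast
    then obtain g where g: "\<And>w. w \<in> ?P \<Longrightarrow> g w \<in> T" "\<And>w. w \<in> ?P \<Longrightarrow> cross (g w) w = 0"
      by metis
    have "inj_on g ?P"
    proof (rule inj_onI, rule ccontr)
      fix v w assume vw: "v \<in> ?P" "w \<in> ?P" "g v = g w" "v \<noteq> w"
      have "cross v w = 0"
        using cross_eq_0_trans[of "g v" v w] g(2)[OF vw(1)] g(2)[OF vw(2)] vw(3) cross_eq_0_commute
          general_position_nonzero[OF Suc.prems(1) g(1)[OF vw(1)]] by metis
      then show False
        using general_positionD[OF P vw(1,2,4)] by blast
    qed
    then have "card ?P \<le> card T"
      using card_inj_on_le[of g ?P T] g(1) Suc.prems(2) by blast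
    then show False
      using card_P Suc.prems(3) by simp
  qed
  then obtain w where w: "w \<in> ?P" "\<And>u. u \<in> T \<Longrightarrow> cross u w \<noteq> 0"
    by blast
  have "w \<notin> T"
    using w(2) cross_self by blast
  moreover have "general_position (insert w T)"
    using Suc.prems(1) general_position_nonzero[OF P w(1)] w(2) cross_eq_0_commute[of _ w]
    unfolding general_position_def pairwise_insert by blast
  ultimately obtain W where W: "finite W" "card W = t" "insert w T \<inter> W = {}"
      "general_position (insert w T \<union> W)"
    using Suc.IH[of "insert w T"] Suc.prems(2,3) by auto
  show ?case
  proof (intro exI conjI)
    show "general_position (T \<union> insert w W)"
      using W(4) by simp
    show "T \<inter> insert w W = {}" "card (insert w W) = Suc t" "finite (insert w W)"
      using W \<open>w \<notin> T\<close> by auto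
  qed
qed

text \<open>Here \<open>V\<close> is the set of missing points and the product over \<open>V\<close>
  is the tangent function of \<open>R\<close>. The constant is the product over all other points of
  the line, independent of \<open>e\<close> by \<open>prod_cross_independent\<close>.\<close>

lemma obtain_tangent_constant:
  fixes R V :: "('a::{field,finite} \<times> 'a) set"
  assumes R: "finite R" "card R + card V = card (UNIV :: 'a set) + 1" "R \<noteq> {}"
    and V: "finite V" "R \<inter> V = {}" "general_position (R \<union> V)"
  obtains c where "c \<noteq> 0"
    "\<And>e. e \<in> R \<Longrightarrow> (\<Prod>u\<in>R - {e}. cross u e) * (\<Prod>u\<in>V. cross u e) = c"
proof -
  obtain e0 where e0: "e0 \<in> R"
    using R(3) by blast
  let ?c = "\<Prod>u\<in>R \<union> V - {e0}. cross u e0"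
  have "cross u e0 \<noteq> 0" if "u \<in> R \<union> V - {e0}" for u
    using general_positionD[OF V(3), of u e0] that e0 by blast
  then have "?c \<noteq> 0"
    using V(1) R(1) by simp
  moreover have "(\<Prod>u\<in>R - {e}. cross u e) * (\<Prod>u\<in>V. cross u e) = ?c" if e: "e \<in> R" for e
  proof -
    have split: "R \<union> V - {e} = (R - {e}) \<union> V" and disj: "(R - {e}) \<inter> V = {}"
      using e V(2) by blast+
    have "(\<Prod>u\<in>R - {e}. cross u e) * (\<Prod>u\<in>V. cross u e) = (\<Prod>u\<in>R \<union> V - {e}. cross u e)"
      unfolding split by (rule prod.union_disjoint[symmetric]) (use R(1) V(1) disj in simp_all)
    also have "\<dots> = ?c"
    proof (rule prod_cross_independent[OF V(3)])
      show "card (R \<union> V) = card (UNIV :: 'a set) + 1"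
        using R(1,2) V(1,2) by (simp add: card_Un_disjoint)
    qed (use e e0 in simp_all)
    finally show ?thesis .
  qed
  ultimately show ?thesis
    by (rule that)
qed

text \<open>
  The assumption on \<open>\<gamma>\<close> says that the tangent functions of \<open>T\<close> and \<open>T'\<close> are proportional on
  \<open>Z\<close>; by interpolation they then vanish at the same points outside \<open>T\<close>.
\<close>

lemma tangents_determined:
  fixes T T' :: "('a::{field,finite} \<times> 'a) set"
  assumes T: "general_position T" "finite T" "card T + t = card (UNIV :: 'a set) + 1"
    and T': "general_position T'" "finite T'" "card T' + t = card (UNIV :: 'a set) + 1"
    and Z: "Z \<subseteq> T" "Z \<subseteq> T'" "card Z = t + 1"
    and \<gamma>: "\<And>e. e \<in> Z \<Longrightarrow> (\<Prod>u\<in>T - {e}. cross u e) = \<gamma> * (\<Prod>u\<in>T' - {e}. cross u e)"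
    and w: "w \<noteq> (0, 0)" "\<And>s. s \<in> T \<Longrightarrow> cross s w \<noteq> 0" and s': "s' \<in> T'"
  shows "cross s' w \<noteq> 0"
proof
  assume "cross s' w = 0"
  obtain W where W: "finite W" "card W = t" "T \<inter> W = {}" "general_position (T \<union> W)"
    using general_position_extend[OF T] by blast
  obtain W' where W': "finite W'" "card W' = t" "T' \<inter> W' = {}" "general_position (T' \<union> W')"
    using general_position_extend[OF T'] by blast
  let ?f = "\<lambda>v. \<Prod>u\<in>W. cross u v" and ?f' = "\<lambda>v. \<Prod>u\<in>W'. cross u v"
  have finZ: "finite Z"
    using Z(1) T(2) finite_subset by blast
  have "T \<noteq> {}" "T' \<noteq> {}"
    using Z by auto
  obtain c where c: "c \<noteq> 0" "\<And>e. e \<in> T \<Longrightarrow> (\<Prod>u\<in>T - {e}. cross u e) * ?f e = c"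
    using obtain_tangent_constant[of T W] T(2,3) \<open>T \<noteq> {}\<close> W by metis
  obtain c' where c': "c' \<noteq> 0" "\<And>e. e \<in> T' \<Longrightarrow> (\<Prod>u\<in>T' - {e}. cross u e) * ?f' e = c'"
    using obtain_tangent_constant[of T' W'] T'(2,3) \<open>T' \<noteq> {}\<close> W' by metis
  have proportional: "c' * \<gamma> * ?f e = c * ?f' e" if "e \<in> Z" for e
  proof -
    let ?p = "\<Prod>u\<in>T' - {e}. cross u e"
    have p': "?p * ?f' e = c'" and p: "\<gamma> * ?p * ?f e = c"
      using c'(2)[of e] c(2)[of e] \<gamma>[OF that] that Z by auto
    show ?thesis
      unfolding p'[symmetric] p[symmetric] by (simp only: ac_simps)
  qed
  have "w \<notin> Z"
    using w(2) Z(1) cross_self by blast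
  \<comment> \<open>With \<open>w\<close> added to the \<open>t + 1\<close> points of
    \<open>Z\<close> there are \<open>t + 2\<close> nodes, as interpolation of a form of degree
    \<open>t\<close> requires; the value at \<open>w\<close> is thus expressed by the values on
    \<open>Z\<close>.\<close>
  have Zw: "general_position (insert w Z)"
    using general_position_subset[OF T(1) Z(1)] w Z(1) cross_eq_0_commute[of _ w]
    unfolding general_position_def pairwise_insert by blast
  have interp: "(\<Prod>u\<in>V. cross u w) / (\<Prod>u\<in>Z. cross u w)
      + (\<Sum>e\<in>Z. (\<Prod>u\<in>V. cross u e) / (\<Prod>u\<in>insert w Z - {e}. cross u e)) = 0"
    if "finite V" "card V = t" for V
    using interpolation_identity[OF that(1) _ _ Zw] finZ Z(3) that(2) \<open>w \<notin> Z\<close> by simp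
  have nz: "(\<Prod>u\<in>Z. cross u w) \<noteq> 0"
    using w(2) Z(1) finZ by auto
  \<comment> \<open>\<open>T\<close> and \<open>W\<close> together are all points of the line, and
    \<open>w\<close> is not in \<open>T\<close>; so it is one of the zeros of
    \<open>?f\<close>.\<close>
  obtain u where u: "u \<in> T \<union> W" "cross u w = 0"
    using general_position_covers[OF W(4), of w] T(2,3) W by (auto simp: card_Un_disjoint)
  then have "u \<in> W"
    using w(2) by blast
  then have "?f w = 0"
    using u(2) by (intro prod_zero[OF W(1)]) blast
  then have sum_f: "(\<Sum>e\<in>Z. ?f e / (\<Prod>u\<in>insert w Z - {e}. cross u e)) = 0"
    using interp[OF W(1,2)] by (simp only: div_0 add_0)
  have "c * (\<Sum>e\<in>Z. ?f' e / (\<Prod>u\<in>insert w Z - {e}. cross u e))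
      = c' * \<gamma> * (\<Sum>e\<in>Z. ?f e / (\<Prod>u\<in>insert w Z - {e}. cross u e))"
    unfolding sum_distrib_left by (rule sum.cong[OF refl]) (simp only: proportional[symmetric] times_divide_eq_right)
  then have "(\<Sum>e\<in>Z. ?f' e / (\<Prod>u\<in>insert w Z - {e}. cross u e)) = 0"
    using sum_f c(1) by simp
  then have "?f' w = 0"
    using interp[OF W'(1,2)] nz by simp
  then obtain u' where u': "u' \<in> W'" "cross u' w = 0"
    using W'(1) by auto
  have "cross s' u' = 0"
    using cross_eq_0_trans[OF w(1) \<open>cross s' w = 0\<close>] u'(2) cross_eq_0_commute by blast
  then show False
    using general_positionD[OF W'(4), of s' u'] s' u'(1) W'(3) by auto
qed

text \<open>The tangent function at \<open>e\<close> is \<open>c\<close> divided by the product over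
  \<open>T - {e}\<close>, so the sum is its interpolation at the nodes \<open>E\<close>, divided by
  \<open>c\<close>.\<close>

lemma sum_inverse_products:
  fixes T :: "('a::{field,finite} \<times> 'a) set"
  assumes T: "general_position T" "finite T" "card T + t = card (UNIV :: 'a set) + 1"
    and E: "E \<subseteq> T" "card E = t + 2"
  shows "(\<Sum>e\<in>E. 1 / ((\<Prod>u\<in>T - {e}. cross u e) * (\<Prod>u\<in>E - {e}. cross u e))) = 0"
proof -
  obtain W where W: "finite W" "card W = t" "T \<inter> W = {}" "general_position (T \<union> W)"
    using general_position_extend[OF T] by blast
  have "T \<noteq> {}"
    using E by auto
  obtain c where c: "c \<noteq> 0"
    "\<And>e. e \<in> T \<Longrightarrow> (\<Prod>u\<in>T - {e}. cross u e) * (\<Prod>u\<in>W. cross u e) = c"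
    using obtain_tangent_constant[of T W] T(2,3) \<open>T \<noteq> {}\<close> W by metis
  have "1 / ((\<Prod>u\<in>T - {e}. cross u e) * (\<Prod>u\<in>E - {e}. cross u e))
      = ((\<Prod>u\<in>W. cross u e) / (\<Prod>u\<in>E - {e}. cross u e)) / c" if "e \<in> E" for e
  proof -
    let ?t = "\<Prod>u\<in>T - {e}. cross u e"
    have "?t * (\<Prod>u\<in>W. cross u e) = c"
      using c(2) that E(1) by blast
    then have "?t \<noteq> 0" "(\<Prod>u\<in>W. cross u e) = c / ?t"
      using c(1) by (auto simp: field_simps)
    then show ?thesis
      using c(1) by simp
  qed
  then have "(\<Sum>e\<in>E. 1 / ((\<Prod>u\<in>T - {e}. cross u e) * (\<Prod>u\<in>E - {e}. cross u e)))
      = (\<Sum>e\<in>E. (\<Prod>u\<in>W. cross u e) / (\<Prod>u\<in>E - {e}. cross u e)) / c"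
    by (simp add: sum_divide_distrib)
  also have "\<dots> = 0"
    using interpolation_identity[OF W(1) _ _ general_position_subset[OF T(1) E(1)]]
      W(2) E finite_subset[OF E(1) T(2)] by simp
  finally show ?thesis .
qed

text \<open>
  In each term of the left kernel identity the sign from moving \<open>e\<close> to its place in \<open>C\<close> occurs
  \<open>q + 1\<close> times; this makes it cancel.
\<close>

lemma involution_power_card:
  fixes \<sigma> :: "'a::{field,finite}"
  assumes "\<sigma> * \<sigma> = 1"
  shows "\<sigma> ^ (card (UNIV :: 'a set) + 1) = 1"
proof -
  have "\<sigma> \<noteq> 0"
    using assms by auto
  have "(\<Prod>x\<in>UNIV - {0}. \<sigma> * x) = \<Prod>(UNIV - {0})"
    using \<open>\<sigma> \<noteq> 0\<close> assms
    by (intro prod.reindex_bij_witness[of _ "\<lambda>x. \<sigma> * x" "\<lambda>x. \<sigma> * x"]) (auto simp flip: mult.assoc)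
  then have "\<sigma> ^ (card (UNIV :: 'a set) - 1) = 1"
    by (simp add: prod.distrib prod_units_eq_minus_1 card_Diff_subset)
  moreover have "card (UNIV :: 'a set) + 1 = (card (UNIV :: 'a set) - 1) + 2"
    using finite_UNIV_card_ge_0[where ?'a = 'a] by simp
  ultimately show ?thesis
    using assms by (simp only: power_add power2_eq_square mult_1)
qed

section \<open>Determinants modulo the span of a set of rows\<close>

lemma det_rows_swap:
  assumes "length xs + length ys + 2 = k"
  shows "det_rows k (xs @ b # a # ys) = - det_rows k (xs @ a # b # ys)"
proof -
  let ?l = "length xs"
  have "mat_of_rows k (xs @ b # a # ys) = swaprows ?l (Suc ?l) (mat_of_rows k (xs @ a # b # ys))"
    using assms by (intro eq_matI) (auto simp: mat_of_rows_def nth_append nth_Cons' split: if_splits)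
  moreover have "mat_of_rows k (xs @ a # b # ys) \<in> carrier_mat k k"
    using assms by (intro carrier_matI) auto
  ultimately show ?thesis
    unfolding det_rows_def using assms det_swaprows[of ?l k "Suc ?l" "mat_of_rows k (xs @ a # b # ys)"]
    by simp
qed

lemma det_rows_move:
  assumes "length P + length xs + length ys + 1 = k"
  shows "det_rows k (P @ xs @ e # ys) = (-1) ^ length xs * det_rows k (P @ e # xs @ ys)"
  using assms
proof (induction xs arbitrary: P)
  case (Cons x xs)
  have "det_rows k (P @ (x # xs) @ e # ys) = (-1) ^ length xs * det_rows k (P @ x # e # xs @ ys)"
    using Cons.IH[of "P @ [x]"] Cons.prems by simp
  also have "\<dots> = (-1) ^ length (x # xs) * det_rows k (P @ e # (x # xs) @ ys)"
    using det_rows_swap[of P "xs @ ys" k x e] Cons.prems by simp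
  finally show ?case .
qed simp

lemma det_rows_not_distinct:
  assumes "length vs = k" "set vs \<subseteq> carrier_vec k" "\<not> distinct vs"
  shows "det_rows k vs = 0"
proof -
  obtain i j where "i < k" "j < k" "i \<noteq> j" "vs ! i = vs ! j"
    using assms by (auto simp: distinct_conv_nth)
  moreover from this have "vs ! i \<in> carrier_vec k" "vs ! j \<in> carrier_vec k"
    using assms nth_mem by blast+
  ultimately show ?thesis
    unfolding det_rows_def using assms(1) by (intro det_identical_rows[of _ k i j]) auto
qed

lemma arc_det_rows_nonzero:
  assumes "arc k S" "set vs \<subseteq> S" "length vs = k" "distinct vs"
  shows "det_rows k vs \<noteq> 0"
proof -
  interpret vec_space "TYPE('a)" k .
  have vs: "set vs \<subseteq> carrier_vec k"
    using assms unfolding arc_def by blast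
  have "basis (set vs)"
    using assms distinct_card[OF assms(4)] unfolding arc_def by blast
  then have "lin_indpt (set vs)"
    unfolding basis_def by blast
  then have "rank (mat_of_cols k vs) = k"
    using vs assms(3,4) by (intro lin_indpt_full_rank) auto
  then have "det (mat_of_cols k vs) \<noteq> 0"
    using det_rank_iff[of "mat_of_cols k vs"] assms(3) by auto
  then show ?thesis
    unfolding det_rows_def using assms(3)
    by (metis det_transpose mat_of_rows_carrier(1) transpose_mat_of_rows)
qed

lemma det_2x2:
  assumes "A \<in> carrier_mat 2 2"
  shows "det A = A $$ (0, 0) * A $$ (1, 1) - A $$ (0, 1) * A $$ (1, 0)"
proof -
  have "det A = (\<Sum>j<2. A $$ (0, j) * cofactor A 0 j)"
    by (rule laplace_expansion_row[OF assms]) simp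
  moreover have "det (mat_delete A 0 j) = A $$ (1, 1 - j)" if "j < 2" for j
    using that assms by (subst det_single) (auto simp: mat_delete_def less_2_cases_iff)
  ultimately show ?thesis
    by (simp add: cofactor_def numeral_2_eq_2)
qed

text \<open>Inverting the matrix with rows \<open>p\<close>, \<open>r\<close>, \<open>A\<close>
  gives \<open>\<alpha>\<close> and, up to scaling, \<open>\<beta>\<close> as its first two columns:
  they read off the coordinates along \<open>p\<close> and \<open>r\<close>, that is, the class of a
  vector modulo the span of \<open>A\<close>.\<close>

lemma pair_coordinates:
  fixes A :: "'a::field vec list"
  assumes len: "length A + 2 = k" and carr: "set (p # r # A) \<subseteq> carrier_vec k"
    and nz: "det_rows k (p # r # A) \<noteq> 0"
  obtains \<alpha> \<beta> where "\<alpha> \<in> carrier_vec k" "\<beta> \<in> carrier_vec k"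
    "\<And>u v. u \<in> carrier_vec k \<Longrightarrow> v \<in> carrier_vec k \<Longrightarrow>
       det_rows k (u # v # A) = cross (u \<bullet> \<alpha>, u \<bullet> \<beta>) (v \<bullet> \<alpha>, v \<bullet> \<beta>)"
    "\<And>u. u \<in> carrier_vec k \<Longrightarrow> u \<bullet> \<alpha> = 0 \<Longrightarrow> u \<bullet> \<beta> = 0 \<Longrightarrow>
       u \<in> LinearCombinations.module.span class_ring (module_vec TYPE('a) k) (set A)"
proof -
  interpret vec_space "TYPE('a)" k .
  let ?B = "mat_of_rows k (p # r # A)"
  have B: "?B \<in> carrier_mat k k"
    using len by (intro carrier_matI) auto
  have "det ?B \<noteq> 0"
    using nz unfolding det_rows_def .
  then obtain B' where B': "B' \<in> carrier_mat k k" "?B * B' = 1\<^sub>m k" "B' * ?B = 1\<^sub>m k"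
    using det_non_zero_imp_unit[OF B] unfolding Units_def by (auto simp: ring_mat_simps)
  define \<alpha> where "\<alpha> = col B' 0"
  \<comment> \<open>The factor \<open>det ?B\<close> makes the determinant formula exact instead of
    valid up to a constant.\<close>
  define \<beta> where "\<beta> = det ?B \<cdot>\<^sub>v col B' 1"
  have \<alpha>: "\<alpha> \<in> carrier_vec k" and \<beta>: "\<beta> \<in> carrier_vec k"
    using B'(1) unfolding \<alpha>_def \<beta>_def by auto
  have dets: "det_rows k (u # v # A) = cross (u \<bullet> \<alpha>, u \<bullet> \<beta>) (v \<bullet> \<alpha>, v \<bullet> \<beta>)"
    if u: "u \<in> carrier_vec k" and v: "v \<in> carrier_vec k" for u v
  proof -
    let ?M = "mat_of_rows k (u # v # A)"
    have M: "?M \<in> carrier_mat k k"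
      using len by (intro carrier_matI) auto
    let ?N = "?M * B'"
    have N: "?N \<in> carrier_mat k k"
      using M B'(1) by simp
    define N1 where "N1 = mat 2 2 (\<lambda>(i, j). ?N $$ (i, j))"
    define N2 where "N2 = mat 2 (length A) (\<lambda>(i, j). ?N $$ (i, j + 2))"
    \<comment> \<open>From the third row on, \<open>?M\<close> and \<open>?B\<close> agree, so
      \<open>?N\<close> has identity rows there and its determinant is that of the upper left 2 by 2
      block.\<close>
    have row: "row ?M i = row ?B i" if "2 \<le> i" "i < k" for i
      using that len by (intro eq_vecI) (auto simp: mat_of_rows_def row_def nth_Cons')
    have N_low: "?N $$ (i, j) = (if i = j then 1 else 0)" if i: "2 \<le> i" "i < k" and j: "j < k" for i j
    proof -
      have "?N $$ (i, j) = row ?M i \<bullet> col B' j"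
        using i j M B'(1) by (intro index_mult_mat) auto
      also have "\<dots> = (?B * B') $$ (i, j)"
        unfolding row[OF i] using i j B B'(1) by (intro index_mult_mat(1)[symmetric]) auto
      finally show ?thesis
        using B'(2) i j by simp
    qed
    have "?N = four_block_mat N1 N2 (0\<^sub>m (length A) 2) (1\<^sub>m (length A))"
    proof (rule eq_matI)
      fix i j
      assume "i < dim_row (four_block_mat N1 N2 (0\<^sub>m (length A) 2) (1\<^sub>m (length A)))"
        "j < dim_col (four_block_mat N1 N2 (0\<^sub>m (length A) 2) (1\<^sub>m (length A)))"
      then have ij: "i < k" "j < k"
        using len by (simp_all add: N1_def N2_def)
      show "?N $$ (i, j) = four_block_mat N1 N2 (0\<^sub>m (length A) 2) (1\<^sub>m (length A)) $$ (i, j)"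
      proof (cases "i < 2")
        case True
        moreover have "Suc (Suc (j - 2)) = j" if "\<not> j < 2"
          using that by simp
        ultimately show ?thesis
          using ij len by (auto simp: N1_def N2_def)
      next
        case False
        then show ?thesis
          using N_low[of i j] ij len by (auto simp: N1_def N2_def)
      qed
    qed (use N len in \<open>auto simp: N1_def N2_def\<close>)
    then have "det ?N = det N1"
      using det_four_block_mat_lower_left_zero[of N1 2 N2 "length A" "0\<^sub>m (length A) 2" "1\<^sub>m (length A)"]
      by (simp add: N1_def N2_def)
    also have "\<dots> = (u \<bullet> col B' 0) * (v \<bullet> col B' 1) - (u \<bullet> col B' 1) * (v \<bullet> col B' 0)"
    proof -
      have "row ?M 0 = u" "row ?M 1 = v"
        using u v by (auto simp: mat_of_rows_row)
      then have "?N $$ (0, j) = u \<bullet> col B' j" "?N $$ (1, j) = v \<bullet> col B' j" if "j < k" for j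
        using that len M B'(1) index_mult_mat(1)[of _ ?M j B'] by auto
      moreover have "N1 \<in> carrier_mat 2 2"
        by (simp add: N1_def)
      ultimately show ?thesis
        using len by (simp add: det_2x2) (simp add: N1_def)
    qed
    finally have detN: "det ?N = (u \<bullet> col B' 0) * (v \<bullet> col B' 1) - (u \<bullet> col B' 1) * (v \<bullet> col B' 0)" .
    have "?N * ?B = ?M"
      using M B B' by (simp add: assoc_mult_mat[of _ k k _ k _ k])
    then have "det ?M = det ?N * det ?B"
      using det_mult[OF N B] by simp
    then show ?thesis
      unfolding det_rows_def detN using B'(1) u v
      by (simp add: cross_def \<alpha>_def \<beta>_def algebra_simps)
  qed
  have kernel: "u \<in> span (set A)" if u: "u \<in> carrier_vec k" "u \<bullet> \<alpha> = 0" "u \<bullet> \<beta> = 0" for u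
  proof -
    \<comment> \<open>The coordinates of \<open>u\<close> in the basis formed by the rows of
      \<open>?B\<close>; the first two vanish, so only rows from \<open>A\<close> remain.\<close>
    define x where "x = B'\<^sup>T *\<^sub>v u"
    have "x $ i = u \<bullet> col B' i" if "i < k" for i
      using u(1) B'(1) that unfolding x_def by (simp add: comm_scalar_prod[of u k])
    then have x: "x \<in> carrier_vec k" "x $ 0 = 0" "x $ 1 = 0"
      using u B'(1) len \<open>det ?B \<noteq> 0\<close> by (auto simp: x_def \<alpha>_def \<beta>_def)
    have "u = ?B\<^sup>T *\<^sub>v x"
      unfolding x_def using B B' u(1)
      by (simp add: assoc_mult_mat_vec[of _ k k _ k, symmetric] transpose_mult[of _ k k _ k, symmetric])
    also have "x = vec (length (p # r # A)) (($) x)"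
      using x(1) len by (intro eq_vecI) auto
    also have "?B\<^sup>T *\<^sub>v \<dots> = mat_of_cols k (p # r # A) *\<^sub>v \<dots>"
      by (simp only: transpose_mat_of_rows)
    also have "\<dots> = lincomb_list (($) x) (p # r # A)"
      using carr by (intro lincomb_list_as_mat_mult[symmetric]) auto
    also have "\<dots> = lincomb_list (($) x \<circ> Suc \<circ> Suc) A"
      using x carr lincomb_list_carrier[of A "($) x \<circ> Suc \<circ> Suc"] by (simp add: o_def)
    finally show ?thesis
      using span_list_as_span[of A] carr unfolding span_list_def by auto
  qed
  show ?thesis
    by (rule that[OF \<alpha> \<beta> dets kernel])
qed

section \<open>Hyperplanes through a fixed \<open>A\<close>\<close>

lemma finite_carrier_vec: "finite (carrier_vec k :: 'a::finite vec set)"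
proof -
  have "carrier_vec k \<subseteq> vec_of_list ` {xs :: 'a list. set xs \<subseteq> UNIV \<and> length xs = k}"
  proof
    fix v :: "'a vec" assume "v \<in> carrier_vec k"
    then show "v \<in> vec_of_list ` {xs. set xs \<subseteq> UNIV \<and> length xs = k}"
      by (intro image_eqI[of _ _ "list_of_vec v"]) (auto simp: vec_list)
  qed
  then show ?thesis
    by (rule finite_surj[rotated]) (rule finite_lists_length_eq[OF finite_class.finite_UNIV])
qed

text \<open>A hyperplane through \<open>A\<close> is a point of the line modulo the span of
  \<open>A\<close>; any vector \<open>w\<close> in it with non-zero coordinates represents that
  point.\<close>

lemma hyperplane_direction:
  fixes A :: "'a::{field,finite} vec list"
  assumes H: "hyperplane k H" and A: "set A \<subseteq> H" and len: "length A + 2 = k"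
    and \<alpha>: "\<alpha> \<in> carrier_vec k" and \<beta>: "\<beta> \<in> carrier_vec k"
    and dets: "\<And>u v. u \<in> carrier_vec k \<Longrightarrow> v \<in> carrier_vec k \<Longrightarrow>
       det_rows k (u # v # A) = cross (u \<bullet> \<alpha>, u \<bullet> \<beta>) (v \<bullet> \<alpha>, v \<bullet> \<beta>)"
    and kernel: "\<And>u. u \<in> carrier_vec k \<Longrightarrow> u \<bullet> \<alpha> = 0 \<Longrightarrow> u \<bullet> \<beta> = 0 \<Longrightarrow>
       u \<in> LinearCombinations.module.span class_ring (module_vec TYPE('a) k) (set A)"
  obtains w where "w \<in> carrier_vec k" "(w \<bullet> \<alpha>, w \<bullet> \<beta>) \<noteq> (0, 0)"
    "\<And>s. s \<in> carrier_vec k \<Longrightarrow> s \<in> H \<longleftrightarrow> cross (s \<bullet> \<alpha>, s \<bullet> \<beta>) (w \<bullet> \<alpha>, w \<bullet> \<beta>) = 0"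
proof -
  interpret vec_space "TYPE('a)" k .
  have sub: "subspace class_ring H V" and dimH: "vectorspace.dim class_ring (vs H) = k - 1"
    using H unfolding hyperplane_def by auto
  have submod: "submodule class_ring H V"
    using sub by (rule is_module)
  interpret Hs: vectorspace class_ring "vs H"
    using sub by (rule subspace_is_vs)
  have HV: "H \<subseteq> carrier_vec k"
    using submod unfolding submodule_def by simp
  have finH: "finite H"
    using HV finite_carrier_vec finite_subset by blast
  have "Hs.fin_dim"
    unfolding Hs.fin_dim_def using finH Hs.in_own_span[of H] Hs.span_is_subset2[of H] by auto
  have spanA: "span (set A) \<subseteq> H"
    by (rule span_is_subset[OF A submod])
  \<comment> \<open>A space of dimension \<open>k - 1\<close> cannot lie in the span of the
    \<open>k - 2\<close> vectors of \<open>A\<close>.\<close>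
  have "\<exists>w\<in>H. (w \<bullet> \<alpha>, w \<bullet> \<beta>) \<noteq> (0, 0)"
  proof (rule ccontr)
    assume "\<not> ?thesis"
    then have HA: "H \<subseteq> span (set A)"
      using kernel HV by blast
    obtain b where b: "finite b" "Hs.basis b"
      using Hs.finite_basis_exists[OF \<open>Hs.fin_dim\<close>] by blast
    then have bH: "b \<subseteq> H" and "Hs.lin_indpt b"
      unfolding Hs.basis_def by auto
    then have "lin_indpt b"
      using span_li_not_depend(2)[OF bH submod] by simp
    have "card b = k - 1"
      using Hs.dim_basis[OF b] dimH by simp
    have "set A \<subseteq> carrier_vec k" "b \<subseteq> span (set A)"
      using A HV bH HA by blast+
    then obtain C :: "'a vec set" where "int (card C) \<le> int (card (set A)) - int (card b)"
      using replacement[OF b(1) finite_set _ \<open>lin_indpt b\<close>] by metis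
    moreover have "card (set A) < card b"
      using card_length[of A] len \<open>card b = k - 1\<close> by linarith
    ultimately show False
      by linarith
  qed
  then obtain w where w: "w \<in> H" "(w \<bullet> \<alpha>, w \<bullet> \<beta>) \<noteq> (0, 0)"
    by blast
  have wV: "w \<in> carrier_vec k"
    using w(1) HV by blast
  have "s \<in> H \<longleftrightarrow> cross (s \<bullet> \<alpha>, s \<bullet> \<beta>) (w \<bullet> \<alpha>, w \<bullet> \<beta>) = 0" if s: "s \<in> carrier_vec k" for s
  proof
    assume sH: "s \<in> H"
    show "cross (s \<bullet> \<alpha>, s \<bullet> \<beta>) (w \<bullet> \<alpha>, w \<bullet> \<beta>) = 0"
    \<comment> \<open>Otherwise \<open>s\<close>, \<open>w\<close> and \<open>A\<close> are
      \<open>k\<close> independent vectors in \<open>H\<close>, against its dimension.\<close>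
    proof (rule ccontr)
      assume "\<not> ?thesis"
      then have nz: "det_rows k (s # w # A) \<noteq> 0"
        using dets[OF s wV] by simp
      let ?L = "s # w # A"
      have L: "set ?L \<subseteq> H" "length ?L = k"
        using sH w(1) A len by auto
      have "distinct ?L"
        using nz det_rows_not_distinct L HV by blast
      then have card: "card (set ?L) = k"
        using distinct_card L(2) by metis
      have "lin_indpt (set (rows (mat_of_rows k ?L)))"
        using nz L(2) unfolding det_rows_def
        by (intro det_not_0_imp_lin_indpt_rows carrier_matI) auto
      then have "lin_indpt (set ?L)"
        using L(1) HV by (metis rows_mat_of_rows subset_trans)
      then have "Hs.lin_indpt (set ?L)"
        using span_li_not_depend(2)[OF L(1) submod] by simp
      then have "card (set ?L) \<le> k - 1"
        using Hs.li_le_dim(2)[OF \<open>Hs.fin_dim\<close>, of "set ?L"] L(1) dimH by simp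
      then show False
        using card len by linarith
    qed
  next
    assume zero: "cross (s \<bullet> \<alpha>, s \<bullet> \<beta>) (w \<bullet> \<alpha>, w \<bullet> \<beta>) = 0"
    \<comment> \<open>The ratio is read off at a non-zero coordinate of \<open>w\<close>; then
      \<open>s - c \<cdot>\<^sub>v w\<close> has both coordinates zero and lies in the span of
      \<open>A\<close>.\<close>
    define c where "c = (if w \<bullet> \<alpha> \<noteq> 0 then (s \<bullet> \<alpha>) / (w \<bullet> \<alpha>) else (s \<bullet> \<beta>) / (w \<bullet> \<beta>))"
    have "s \<bullet> \<alpha> = c * (w \<bullet> \<alpha>)" "s \<bullet> \<beta> = c * (w \<bullet> \<beta>)"
      using zero w(2) unfolding cross_def c_def by (auto simp: field_simps)
    then have "(s - c \<cdot>\<^sub>v w) \<bullet> \<alpha> = 0" "(s - c \<cdot>\<^sub>v w) \<bullet> \<beta> = 0"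
      using s wV \<alpha> \<beta> by (simp_all add: minus_scalar_prod_distrib[of _ k])
    then have "s - c \<cdot>\<^sub>v w \<in> H"
      using kernel[of "s - c \<cdot>\<^sub>v w"] s wV spanA by auto
    moreover have "c \<cdot>\<^sub>v w \<in> H"
      using submodule.smult_closed[OF submod, of c w] w(1) by simp
    ultimately have "(s - c \<cdot>\<^sub>v w) + c \<cdot>\<^sub>v w \<in> H"
      using submodule.m_closed[OF submod, of "s - c \<cdot>\<^sub>v w" "c \<cdot>\<^sub>v w"] by simp
    moreover have "(s - c \<cdot>\<^sub>v w) + c \<cdot>\<^sub>v w = s"
      using s wV by (intro eq_vecI) auto
    ultimately show "s \<in> H"
      by simp
  qed
  then show ?thesis
    using that wV w(2) by blast
qed

section \<open>The left kernel of the matrix\<close>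

lemma subseqs_eq_filter:
  assumes "distinct G" "xs \<in> set (subseqs G)"
  shows "filter (\<lambda>x. x \<in> set xs) G = xs"
  using assms
proof (induction G arbitrary: xs)
  case (Cons y G)
  then consider ys where "xs = y # ys" "ys \<in> set (subseqs G)" | "xs \<in> set (subseqs G)"
    by (auto simp: Let_def)
  then show ?case
  proof cases
    case 1
    have "filter (\<lambda>x. x \<in> set xs) G = filter (\<lambda>x. x \<in> set ys) G"
      using Cons.prems(1) 1(1) by (intro filter_cong) auto
    then show ?thesis
      using Cons.IH[of ys] Cons.prems(1) 1 by simp
  next
    case 2
    then have "set xs \<subseteq> set G"
      using subseqs_powset[of G] by blast
    then show ?thesis
      using Cons.IH[OF _ 2] Cons.prems(1) by auto
  qed
qed simp

lemma filter_in_subseqs: "filter P xs \<in> set (subseqs xs)"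
  by (induction xs) (auto simp: Let_def)

text \<open>A sublist of a distinct list is determined by its set, so being an ordered subset
  becomes a fixed-point equation for \<open>filter\<close>; later lemmas state it in this
  form.\<close>

lemma mem_sublists_of_size_iff:
  assumes "distinct G"
  shows "xs \<in> set (sublists_of_size m G) \<longleftrightarrow> filter (\<lambda>x. x \<in> set xs) G = xs \<and> length xs = m"
  unfolding sublists_of_size_def
  using subseqs_eq_filter[OF assms] filter_in_subseqs[of "\<lambda>x. x \<in> set xs" G] by auto

lemma sublists_of_size_trans:
  assumes "distinct G" "E \<in> set (sublists_of_size l G)" "A \<in> set (sublists_of_size m E)"
  shows "A \<in> set (sublists_of_size m G)"
proof -
  have E: "filter (\<lambda>x. x \<in> set E) G = E"
    using assms(1,2) mem_sublists_of_size_iff by blast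
  then have "distinct E"
    using assms(1) by (metis distinct_filter)
  then have A: "filter (\<lambda>x. x \<in> set A) E = A" "length A = m"
    using assms(3) mem_sublists_of_size_iff by blast+
  have "filter (\<lambda>x. x \<in> set A) (filter (\<lambda>x. x \<in> set E) G) = A"
    using A E by simp
  moreover have "set A \<subseteq> set E"
    using A(1) filter_is_subset by metis
  ultimately have "filter (\<lambda>x. x \<in> set A) G = A"
    by (metis (mono_tags, lifting) filter_cong filter_filter subsetD)
  then show ?thesis
    using assms(1) A(2) mem_sublists_of_size_iff by blast
qed

section \<open>Row labels above a fixed \<open>A\<close>, and their signs\<close>

definition add_point :: "'b list \<Rightarrow> 'b list \<Rightarrow> 'b \<Rightarrow> 'b list" where
  "add_point G A e = filter (\<lambda>x. x \<in> insert e (set A)) G"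

text \<open>\<open>\<sigma>\<close> is the sign of moving \<open>e\<close> from its place in the
  order of \<open>G\<close> to the front of \<open>A\<close>, hence the same for every
  \<open>u\<close>.\<close>

lemma det_rows_add_point:
  fixes G :: "'a::field vec list"
  assumes "distinct G" "filter (\<lambda>x. x \<in> set A) G = A" "length A + 2 = k" "e \<in> set G - set A"
  shows "\<exists>\<sigma>. \<sigma> * \<sigma> = 1 \<and> (\<forall>u. det_rows k (u # add_point G A e) = \<sigma> * det_rows k (u # e # A))"
proof -
  obtain G1 G2 where G: "G = G1 @ e # G2"
    using assms(4) split_list by fast
  let ?A1 = "filter (\<lambda>x. x \<in> set A) G1" and ?A2 = "filter (\<lambda>x. x \<in> set A) G2"
  have A: "A = ?A1 @ ?A2"
    using assms(2,4) unfolding G by simp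
  have "filter (\<lambda>x. x \<in> insert e (set A)) G' = filter (\<lambda>x. x \<in> set A) G'" if "e \<notin> set G'" for G'
    using that by (intro filter_cong) auto
  then have "add_point G A e = ?A1 @ e # ?A2"
    using assms(1) unfolding G add_point_def by simp
  moreover have "det_rows k ([u] @ ?A1 @ e # ?A2) = (-1) ^ length ?A1 * det_rows k ([u] @ e # ?A1 @ ?A2)" for u
    using arg_cong[OF A, of length] assms(3) by (intro det_rows_move) simp
  ultimately have "det_rows k (u # add_point G A e) = (-1) ^ length ?A1 * det_rows k (u # e # A)" for u
    using A by simp
  moreover have "(-1) ^ length ?A1 * (-1) ^ length ?A1 = (1 :: 'a)"
    by (simp flip: power_mult_distrib)
  ultimately show ?thesis
    by blast
qed

lemma set_add_point:
  assumes "filter (\<lambda>x. x \<in> set A) G = A" "e \<in> set G"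
  shows "set (add_point G A e) = insert e (set A)"
proof -
  have "set A \<subseteq> set G"
    using assms(1) filter_is_subset by metis
  then show ?thesis
    using assms(2) unfolding add_point_def by auto
qed

lemma rowsD:
  assumes "distinct G" "C \<in> set (M_rows k G)"
  shows "filter (\<lambda>x. x \<in> set C) G = C" "length C = k - 1" "distinct C" "set C \<subseteq> set G"
proof -
  show C: "filter (\<lambda>x. x \<in> set C) G = C" "length C = k - 1"
    using assms unfolding M_rows_def by (simp_all add: mem_sublists_of_size_iff)
  show "distinct C" "set C \<subseteq> set G"
    using C(1) assms(1) filter_is_subset by (metis distinct_filter, metis)
qed

lemma rows_above_eq_add_point:
  assumes G: "distinct G" and A: "filter (\<lambda>x. x \<in> set A) G = A" "length A + 2 = k"
    and C: "C \<in> set (M_rows k G)" "set A \<subseteq> set C"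
  obtains e where "e \<in> set G - set A" "C = add_point G A e"
proof -
  note C' = rowsD[OF G C(1)]
  have "distinct A"
    using A(1) G by (metis distinct_filter)
  then have "card (set C - set A) = 1"
    using C(2) C'(2,3) A(2) by (simp add: card_Diff_subset distinct_card)
  then obtain e where e: "set C - set A = {e}"
    using card_1_singletonE by blast
  then have "set C = insert e (set A)"
    using C(2) by blast
  then show ?thesis
    using that[of e] e C'(1,4) unfolding add_point_def by auto
qed

lemma add_point_in_rows:
  assumes G: "distinct G" and A: "filter (\<lambda>x. x \<in> set A) G = A" "length A + 2 = k"
    and e: "e \<in> set G - set A"
  shows "add_point G A e \<in> set (M_rows k G)"
proof -
  have "distinct A"
    using A(1) G by (metis distinct_filter)
  then have "card (set (add_point G A e)) = k - 1"
    using set_add_point[OF A(1), of e] e A(2) by (simp add: distinct_card)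
  moreover have "distinct (add_point G A e)"
    using G by (simp add: add_point_def)
  ultimately have "length (add_point G A e) = k - 1"
    by (simp add: distinct_card)
  moreover have "filter (\<lambda>x. x \<in> set (add_point G A e)) G = add_point G A e"
    using set_add_point[OF A(1), of e] e unfolding add_point_def by simp
  ultimately show ?thesis
    unfolding M_rows_def mem_sublists_of_size_iff[OF G] by simp
qed

lemma inj_on_add_point:
  assumes "filter (\<lambda>x. x \<in> set A) G = A"
  shows "inj_on (add_point G A) (set G - set A)"
proof (rule inj_onI)
  fix e e' assume e: "e \<in> set G - set A" "e' \<in> set G - set A" "add_point G A e = add_point G A e'"
  then have "insert e (set A) = insert e' (set A)"
    using set_add_point[OF assms] by (metis DiffD1)
  then show "e = e'"
    using e(1,2) by blast
qed

section \<open>Row weights and one column of the matrix\<close>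

definition row_weight :: "nat \<Rightarrow> 'a::field vec set \<Rightarrow> 'a vec list \<Rightarrow> 'a" where
  "row_weight k S C = (\<Prod>u\<in>S - set C. det_rows k (u # C))"

lemma row_weight_nonzero:
  assumes "arc k S" "finite S" "set C \<subseteq> S" "distinct C" "length C + 1 = k"
  shows "row_weight k S C \<noteq> 0"
  using assms arc_det_rows_nonzero[of k S "_ # C"] unfolding row_weight_def by simp

text \<open>\<open>A\<close> and the coordinates modulo its span stay fixed while \<open>S\<close>
  varies, so two arcs can be compared in the same coordinates. By \<open>card_S\<close>, exactly
  \<open>t\<close> points of the line are missed by \<open>S - set A\<close>.\<close>

locale arc_above =
  fixes k t :: nat and G A :: "'a::{field,finite} vec list" and \<alpha> \<beta> :: "'a vec" and S :: "'a vec set"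
  assumes G: "distinct G" and A: "filter (\<lambda>x. x \<in> set A) G = A" "length A + 2 = k"
    and arc: "arc k S" and GS: "set G \<subseteq> S"
    and card_S: "card S + t + 1 = card (UNIV :: 'a set) + k"
    and card_G: "k \<le> card (set G)"
    and dets: "\<And>u v. u \<in> carrier_vec k \<Longrightarrow> v \<in> carrier_vec k \<Longrightarrow>
       det_rows k (u # v # A) = cross (u \<bullet> \<alpha>, u \<bullet> \<beta>) (v \<bullet> \<alpha>, v \<bullet> \<beta>)"
begin

definition coords :: "'a vec \<Rightarrow> 'a \<times> 'a" where
  "coords u = (u \<bullet> \<alpha>, u \<bullet> \<beta>)"

definition points :: "('a \<times> 'a) set" where
  "points = coords ` (S - set A)"

lemma carr: "S \<subseteq> carrier_vec k"
  using arc unfolding arc_def by blast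

lemma fin: "finite S"
  using carr finite_carrier_vec finite_subset by blast

lemma AG: "set A \<subseteq> set G"
  using A(1) filter_is_subset by metis

lemma AS: "set A \<subseteq> S"
  using AG GS by blast

lemma distinct_A: "distinct A"
  using A(1) G by (metis distinct_filter)

lemma card_A: "card (set A) + 2 = k"
  using distinct_A A(2) by (simp add: distinct_card)

lemma det_eq_cross: "u \<in> S \<Longrightarrow> v \<in> S \<Longrightarrow> det_rows k (u # v # A) = cross (coords u) (coords v)"
  using dets carr unfolding coords_def by blast

lemma cross_coords_nonzero:
  assumes "u \<in> S - set A" "v \<in> S - set A" "u \<noteq> v"
  shows "cross (coords u) (coords v) \<noteq> 0"
proof -
  have "det_rows k (u # v # A) \<noteq> 0"
    using assms A(2) distinct_A AS by (intro arc_det_rows_nonzero[OF arc]) auto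
  then show ?thesis
    using det_eq_cross assms by auto
qed

lemma inj_coords: "inj_on coords (S - set A)"
  by (rule inj_onI, rule ccontr) (metis cross_coords_nonzero cross_self)

lemma card_diff: "card (S - set A) + t = card (UNIV :: 'a set) + 1"
  using card_S card_A fin AS by (simp add: card_Diff_subset) (use card_mono[OF fin AS] in linarith)

lemma card_points: "card points + t = card (UNIV :: 'a set) + 1"
  unfolding points_def card_image[OF inj_coords] by (rule card_diff)

lemma finite_points: "finite points"
  unfolding points_def using fin by simp

lemma two_points: "\<exists>p\<in>set G - set A. \<exists>r\<in>set G - set A. p \<noteq> r"
proof -
  have "\<not> card (set G - set A) \<le> Suc 0"
    using card_G card_A AG by (simp add: card_Diff_subset)
  then show ?thesis
    using card_le_Suc0_iff_eq[of "set G - set A"] by auto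
qed

lemma general_position_points: "general_position points"
  unfolding general_position_def
proof
  show "\<forall>x\<in>points. x \<noteq> (0, 0)"
  proof
    fix x assume "x \<in> points"
    then obtain u where u: "u \<in> S - set A" "x = coords u"
      unfolding points_def by blast
    obtain v where "v \<in> S - set A" "v \<noteq> u"
      using two_points GS by blast
    then have "cross x (coords v) \<noteq> 0"
      using cross_coords_nonzero u by metis
    then show "x \<noteq> (0, 0)"
      by (auto simp: cross_def)
  qed
  show "pairwise (\<lambda>x y. cross x y \<noteq> 0) points"
    unfolding points_def pairwise_def using cross_coords_nonzero by auto
qed

lemma prod_coords:
  assumes "X \<subseteq> S - set A" "e \<in> X"
  shows "(\<Prod>u\<in>X - {e}. det_rows k (u # e # A)) = (\<Prod>x\<in>coords ` X - {coords e}. cross x (coords e))"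
proof -
  have inj: "inj_on coords X"
    using inj_coords assms(1) inj_on_subset by blast
  have "coords ` X - {coords e} = coords ` (X - {e})"
    using inj assms(2) by (auto simp: inj_on_def)
  moreover have "inj_on coords (X - {e})"
    using inj by (rule inj_on_subset) blast
  ultimately have "(\<Prod>x\<in>coords ` X - {coords e}. cross x (coords e))
      = (\<Prod>u\<in>X - {e}. cross (coords u) (coords e))"
    by (simp add: prod.reindex)
  also have "\<dots> = (\<Prod>u\<in>X - {e}. det_rows k (u # e # A))"
    using assms by (intro prod.cong[OF refl] det_eq_cross[symmetric]) auto
  finally show ?thesis
    by simp
qed

text \<open>Each of the \<open>card X - (k - 1)\<close> factors contributes one sign
  \<open>\<sigma>\<close>. Applied both to the arc and to the set \<open>E\<close> of a
  column.\<close>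

lemma prod_det_add_point:
  assumes e: "e \<in> X - set A" and X: "X \<subseteq> S" "set A \<subseteq> X" and eG: "e \<in> set G"
    and \<sigma>: "\<And>u. det_rows k (u # add_point G A e) = \<sigma> * det_rows k (u # e # A)"
  shows "(\<Prod>u\<in>X - set (add_point G A e). det_rows k (u # add_point G A e))
    = \<sigma> ^ (card X - (k - 1)) * (\<Prod>x\<in>coords ` (X - set A) - {coords e}. cross x (coords e))"
proof -
  have set: "X - set (add_point G A e) = X - set A - {e}"
    using set_add_point[OF A(1) eG] by auto
  have "card (insert e (set A)) = k - 1"
    using e card_A by auto
  moreover have "insert e (set A) \<subseteq> X"
    using e X by auto
  ultimately have "card (X - set A - {e}) = card X - (k - 1)"
    by (metis (no_types, lifting) Diff_insert card_Diff_subset finite_subset X(1) fin)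
  then show ?thesis
    unfolding set \<sigma> prod.distrib prod_constant
    using prod_coords[of "X - set A" e] e X by auto
qed

lemma row_weight_add_point:
  assumes e: "e \<in> set G - set A"
    and \<sigma>: "\<And>u. det_rows k (u # add_point G A e) = \<sigma> * det_rows k (u # e # A)"
  shows "row_weight k S (add_point G A e)
    = \<sigma> ^ (card S - (k - 1)) * (\<Prod>x\<in>points - {coords e}. cross x (coords e))"
  unfolding row_weight_def points_def
  by (rule prod_det_add_point) (use e GS AS \<sigma> in auto)

text \<open>Dividing the entry by the weight of \<open>G\<close> leaves the inverse of the product
  over \<open>E\<close> outside \<open>C\<close>, so the sum becomes
  \<open>sum_inverse_products\<close> at the \<open>t + 2\<close> points of
  \<open>set E - set A\<close>.\<close>

lemma weighted_column_sum:
  assumes E: "E \<in> set (sublists_of_size (length G - n) G)" "set A \<subseteq> set E"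
    and t: "length G = n + k + t"
  shows "(\<Sum>C\<in>set (M_rows k G). M_entry k G C (A, E) / (row_weight k S C * row_weight k (set G) C)) = 0"
proof -
  let ?g = "\<lambda>C. M_entry k G C (A, E) / (row_weight k S C * row_weight k (set G) C)"
  have E': "filter (\<lambda>x. x \<in> set E) G = E" "length E = k + t"
    using E(1) t unfolding mem_sublists_of_size_iff[OF G] by auto
  have EG: "set E \<subseteq> set G"
    using E'(1) filter_is_subset by metis
  then have ES: "set E \<subseteq> S"
    using GS by blast
  have card_E: "card (set E) = k + t"
    using E' G by (metis distinct_card distinct_filter)
  let ?D = "set E - set A"
  have inj: "inj_on (add_point G A) ?D"
    using inj_on_add_point[OF A(1)] EG by (blast intro: inj_on_subset)
  \<comment> \<open>If the added point \<open>e\<close> lies outside \<open>E\<close>, the entry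
    contains the factor \<open>det_rows k (e # C)\<close>, which has a repeated row.\<close>
  have "?g C = 0" if C: "C \<in> set (M_rows k G) - add_point G A ` ?D" for C
  proof (cases "set A \<subset> set C")
    case True
    then obtain e where e: "e \<in> set G - set A" "C = add_point G A e"
      using rows_above_eq_add_point[OF G A, of C] C by blast
    then have eE: "e \<in> set G - set E"
      using C by blast
    have "e \<in> set C"
      using e set_add_point[OF A(1)] by blast
    moreover have "set C \<subseteq> carrier_vec k" "length C + 1 = k"
      using rowsD[OF G, of C k] C GS carr A(2) by auto
    ultimately have "det_rows k (e # C) = 0"
      by (intro det_rows_not_distinct) auto
    then show ?thesis
      using eE unfolding M_entry_def by (auto intro: prod_zero)
  qed (simp add: M_entry_def)
  then have "(\<Sum>C\<in>set (M_rows k G). ?g C) = (\<Sum>C\<in>add_point G A ` ?D. ?g C)"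
    using add_point_in_rows[OF G A] EG by (intro sum.mono_neutral_right) auto
  also have "\<dots> = (\<Sum>e\<in>?D. ?g (add_point G A e))"
    by (simp add: sum.reindex[OF inj])
  also have "\<dots> = (\<Sum>e\<in>?D. 1 / ((\<Prod>x\<in>points - {coords e}. cross x (coords e))
      * (\<Prod>x\<in>coords ` ?D - {coords e}. cross x (coords e))))"
  proof (rule sum.cong[OF refl])
    fix e assume e: "e \<in> ?D"
    let ?C = "add_point G A e"
    have eG: "e \<in> set G - set A"
      using e EG by blast
    obtain \<sigma> where \<sigma>: "\<sigma> * \<sigma> = 1" "\<And>u. det_rows k (u # ?C) = \<sigma> * det_rows k (u # e # A)"
      using det_rows_add_point[OF G A eG] by blast
    have setC: "set ?C = insert e (set A)"
      using set_add_point[OF A(1)] eG by blast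
    note C = rowsD[OF G add_point_in_rows[OF G A eG]]
    have lenC: "length ?C + 1 = k"
      using C(2) A(2) by simp
    have arcG: "arc k (set G)"
      using arc GS unfolding arc_def by blast
    have "row_weight k (set G) ?C \<noteq> 0"
      using row_weight_nonzero[OF arcG _ C(4,3) lenC] by simp
    moreover have "row_weight k (set G) ?C
        = (\<Prod>u\<in>set G - set E. det_rows k (u # ?C)) * (\<Prod>u\<in>set E - set ?C. det_rows k (u # ?C))"
    proof -
      have "set G - set ?C = (set G - set E) \<union> (set E - set ?C)"
        using setC e E(2) EG by auto
      then show ?thesis
        unfolding row_weight_def by (simp only:) (intro prod.union_disjoint, auto)
    qed
    moreover have "set A \<subset> set ?C"
      using setC e by blast
    ultimately have "?g ?C = 1 / (row_weight k S ?C * (\<Prod>u\<in>set E - set ?C. det_rows k (u # ?C)))"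
      unfolding M_entry_def by simp
    also have "row_weight k S ?C * (\<Prod>u\<in>set E - set ?C. det_rows k (u # ?C))
        = \<sigma> ^ (card S - (k - 1)) * \<sigma> ^ (card (set E) - (k - 1))
          * ((\<Prod>x\<in>points - {coords e}. cross x (coords e))
             * (\<Prod>x\<in>coords ` ?D - {coords e}. cross x (coords e)))"
      unfolding row_weight_add_point[OF eG \<sigma>(2)]
      by (subst prod_det_add_point[OF e ES E(2) _ \<sigma>(2)]) (use eG in \<open>simp_all only: ac_simps DiffD1\<close>)
    \<comment> \<open>\<open>S\<close> contributes \<open>q - t\<close> signs and \<open>E\<close>
      contributes \<open>t + 1\<close>, in all \<open>q + 1\<close>.\<close>
    also have "\<sigma> ^ (card S - (k - 1)) * \<sigma> ^ (card (set E) - (k - 1)) = 1"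
    proof -
      have "card S - (k - 1) + (card (set E) - (k - 1)) = card (UNIV :: 'a set) + 1"
        using card_S card_E A(2) card_mono[OF fin GS] card_G by simp
      then show ?thesis
        using involution_power_card[OF \<sigma>(1)] by (simp flip: power_add)
    qed
    finally show "?g ?C = 1 / ((\<Prod>x\<in>points - {coords e}. cross x (coords e))
      * (\<Prod>x\<in>coords ` ?D - {coords e}. cross x (coords e)))"
      by simp
  qed
  also have "\<dots> = (\<Sum>y\<in>coords ` ?D. 1 / ((\<Prod>x\<in>points - {y}. cross x y)
      * (\<Prod>x\<in>coords ` ?D - {y}. cross x y)))"
    using inj_on_subset[OF inj_coords, of ?D] ES by (subst sum.reindex) auto
  also have "\<dots> = 0"
  proof (rule sum_inverse_products[OF general_position_points finite_points card_points])
    show "coords ` ?D \<subseteq> points"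
      unfolding points_def using ES by blast
    have "card (coords ` ?D) = card ?D"
      using inj_on_subset[OF inj_coords, of ?D] ES by (intro card_image) auto
    then show "card (coords ` ?D) = t + 2"
      using card_E card_A E(2) by (simp add: card_Diff_subset)
  qed
  finally show ?thesis .
qed

end

section \<open>Comparing two arcs that contain \<open>G\<close>\<close>

lemma distinct_subseqs: "distinct xs \<Longrightarrow> distinct (subseqs xs)"
  using distinct_set_subseqs distinct_map by blast

text \<open>Every left kernel vector is orthogonal to \<open>w\<close>; as \<open>w\<close> has only
  two non-zero coordinates, it alone fixes the ratio of the entries at \<open>C\<close> and
  \<open>C'\<close>.\<close>

lemma left_kernel_two_point_support:
  assumes G: "distinct G"
    and w: "w \<in> M_column_space k G n" and supp: "M_support k G w = {C, C'}" and ne: "C \<noteq> C'"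
    and kernel: "\<And>c. c \<in> set (M_cols k G n) \<Longrightarrow> (\<Sum>C\<in>set (M_rows k G). b C * M_entry k G C c) = 0"
    and kernel': "\<And>c. c \<in> set (M_cols k G n) \<Longrightarrow> (\<Sum>C\<in>set (M_rows k G). b' C * M_entry k G C c) = 0"
  shows "b C * b' C' = b' C * b C'"
proof -
  let ?r = "length (M_rows k G)"
  interpret vec_space "TYPE('a)" ?r .
  have M: "M_mat k G n \<in> carrier_mat ?r (length (M_cols k G n))"
    unfolding M_mat_def by simp
  obtain x where x: "x \<in> carrier_vec (length (M_cols k G n))" "w = M_mat k G n *\<^sub>v x"
    using w M unfolding M_column_space_def col_space_eq[OF M] by auto
  have rows: "distinct (M_rows k G)"
    unfolding M_rows_def sublists_of_size_def using distinct_subseqs[OF G] by simp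
  have "C \<in> M_support k G w" "C' \<in> M_support k G w"
    using supp by auto
  then obtain i i' where i: "i < ?r" "M_rows k G ! i = C" "w $ i \<noteq> 0"
    and i': "i' < ?r" "M_rows k G ! i' = C'" "w $ i' \<noteq> 0"
    unfolding M_support_def by blast
  have "i \<noteq> i'"
    using i i' ne by blast
  have zero: "w $ j = 0" if j: "j < ?r" "j \<noteq> i" "j \<noteq> i'" for j
  proof (rule ccontr)
    assume "w $ j \<noteq> 0"
    then have "M_rows k G ! j \<in> {C, C'}"
      using j(1) unfolding supp[symmetric] M_support_def by blast
    then show False
      using j i i' rows nth_eq_iff_index_eq by blast
  qed
  have relation: "b C * w $ i + b C' * w $ i' = 0"
    if b: "\<And>c. c \<in> set (M_cols k G n) \<Longrightarrow> (\<Sum>C\<in>set (M_rows k G). b C * M_entry k G C c) = 0" for b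
  proof -
    let ?b = "\<lambda>j. b (M_rows k G ! j)"
    have "(\<Sum>j<?r. ?b j * w $ j) = (\<Sum>j\<in>{i, i'}. ?b j * w $ j)"
      using zero i(1) i'(1) by (intro sum.mono_neutral_right) auto
    moreover have "(\<Sum>j<?r. ?b j * w $ j) = 0"
    proof -
      have "(\<Sum>j<?r. ?b j * w $ j)
          = (\<Sum>j<?r. \<Sum>l<length (M_cols k G n). ?b j * (M_entry k G (M_rows k G ! j) (M_cols k G n ! l) * x $ l))"
        using x M unfolding M_mat_def
        by (intro sum.cong[OF refl]) (simp add: scalar_prod_def sum_distrib_left lessThan_atLeast0)
      also have "\<dots> = (\<Sum>l<length (M_cols k G n). x $ l *
          (\<Sum>j<?r. ?b j * M_entry k G (M_rows k G ! j) (M_cols k G n ! l)))"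
        by (subst sum.swap) (simp add: sum_distrib_left ac_simps)
      also have "\<dots> = (\<Sum>l<length (M_cols k G n). x $ l *
          (\<Sum>C\<in>set (M_rows k G). b C * M_entry k G C (M_cols k G n ! l)))"
        by (subst sum.reindex_bij_betw[OF bij_betw_nth[OF rows refl refl], symmetric]) simp
      also have "\<dots> = 0"
        using b by (intro sum.neutral) simp
      finally show ?thesis .
    qed
    ultimately show ?thesis
      using \<open>i \<noteq> i'\<close> i(2) i'(2) by simp
  qed
  have "b C * w $ i = - (b C' * w $ i')" "b' C * w $ i = - (b' C' * w $ i')"
    using relation[OF kernel] relation[OF kernel'] by (simp_all add: add_eq_0_iff2)
  then have "(b C * b' C') * (w $ i * w $ i') = (b' C * b C') * (w $ i * w $ i')"
    by (metis (no_types, lifting) mult.assoc mult.commute mult_minus_left mult_minus_right)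
  then show ?thesis
    using i(3) i'(3) by simp
qed

text \<open>The vectors \<open>p\<close> and \<open>r\<close> are chosen in \<open>G\<close>, so the
  same coordinates serve every arc containing \<open>G\<close>.\<close>

lemma arc_pair_coordinates:
  fixes G :: "'a::field vec list"
  assumes G: "distinct G" and A: "filter (\<lambda>x. x \<in> set A) G = A" "length A + 2 = k"
    and arc: "arc k (set G)" and card: "k \<le> card (set G)"
  obtains \<alpha> \<beta> where "\<alpha> \<in> carrier_vec k" "\<beta> \<in> carrier_vec k"
    "\<And>u v. u \<in> carrier_vec k \<Longrightarrow> v \<in> carrier_vec k \<Longrightarrow>
       det_rows k (u # v # A) = cross (u \<bullet> \<alpha>, u \<bullet> \<beta>) (v \<bullet> \<alpha>, v \<bullet> \<beta>)"
    "\<And>u. u \<in> carrier_vec k \<Longrightarrow> u \<bullet> \<alpha> = 0 \<Longrightarrow> u \<bullet> \<beta> = 0 \<Longrightarrow>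
       u \<in> LinearCombinations.module.span class_ring (module_vec TYPE('a) k) (set A)"
proof -
  have AG: "set A \<subseteq> set G"
    using A(1) filter_is_subset by metis
  have dA: "distinct A"
    using A(1) G by (metis distinct_filter)
  have "\<not> card (set G - set A) \<le> Suc 0"
    using card AG A(2) dA by (simp add: card_Diff_subset distinct_card)
  then obtain p r where pr: "p \<in> set G - set A" "r \<in> set G - set A" "p \<noteq> r"
    using card_le_Suc0_iff_eq[of "set G - set A"] by auto
  have sub: "set (p # r # A) \<subseteq> set G"
    using pr AG by auto
  have "det_rows k (p # r # A) \<noteq> 0"
    using pr A(2) dA by (intro arc_det_rows_nonzero[OF arc sub]) auto
  moreover have "set (p # r # A) \<subseteq> carrier_vec k"
    using sub arc unfolding arc_def by blast
  ultimately show ?thesis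
    using pair_coordinates[OF A(2), of p r] that by blast
qed

text \<open>A weight depends on \<open>C\<close> alone, so one vector annihilates the columns of
  every \<open>A\<close>; each column is treated in coordinates for its own
  \<open>A\<close>.\<close>

lemma left_kernel:
  fixes G :: "'a::{field,finite} vec list"
  assumes k: "k \<ge> 2" and G: "distinct G" and t: "length G = n + k + t"
    and S: "arc k S" "set G \<subseteq> S" "card S + t + 1 = card (UNIV :: 'a set) + k"
    and c: "c \<in> set (M_cols k G n)"
  shows "(\<Sum>C\<in>set (M_rows k G). 1 / (row_weight k S C * row_weight k (set G) C) * M_entry k G C c) = 0"
proof -
  obtain A E where c': "c = (A, E)" "E \<in> set (sublists_of_size (length G - n) G)"
    "A \<in> set (sublists_of_size (k - 2) E)"
    using c unfolding M_cols_def by auto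
  have "A \<in> set (sublists_of_size (k - 2) G)"
    using sublists_of_size_trans[OF G c'(2,3)] .
  then have A: "filter (\<lambda>x. x \<in> set A) G = A" "length A + 2 = k"
    using k unfolding mem_sublists_of_size_iff[OF G] by auto
  have "distinct E"
    using c'(2) G unfolding mem_sublists_of_size_iff[OF G] by (metis distinct_filter)
  then have AE: "set A \<subseteq> set E"
    using c'(3) filter_is_subset mem_sublists_of_size_iff by metis
  have arcG: "arc k (set G)"
    using S(1,2) unfolding arc_def by blast
  have card_G: "k \<le> card (set G)"
    using G t by (simp add: distinct_card)
  obtain \<alpha> \<beta> where dets: "\<And>u v. u \<in> carrier_vec k \<Longrightarrow> v \<in> carrier_vec k \<Longrightarrow>
       det_rows k (u # v # A) = cross (u \<bullet> \<alpha>, u \<bullet> \<beta>) (v \<bullet> \<alpha>, v \<bullet> \<beta>)"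
    using arc_pair_coordinates[OF G A arcG card_G] by metis
  interpret arc_above k t G A \<alpha> \<beta> S
    using G A S card_G dets by unfold_locales
  show ?thesis
    using weighted_column_sum[OF c'(2) AE t] c'(1) by simp
qed

text \<open>Modulo the span of \<open>A\<close>, \<open>H\<close> is a point of the line that
  \<open>S\<close> misses; the ratios fixed by \<open>G\<close> make \<open>S'\<close> miss it too.
  Exchanging the arcs gives the other inclusion.\<close>

lemma cosecant_in_transfer:
  fixes G :: "'a::{field,finite} vec list"
  assumes k: "k \<ge> 2" and G: "distinct G" and t: "length G = n + k + t"
    and W: "property_W k G n"
    and S: "arc k S" "set G \<subseteq> S" "card S + t + 1 = card (UNIV :: 'a set) + k"
    and S': "arc k S'" "set G \<subseteq> S'" "card S' + t + 1 = card (UNIV :: 'a set) + k"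
    and H: "cosecant k S H" "H \<inter> S \<subseteq> set G"
  shows "cosecant k S' H \<and> H \<inter> S' \<subseteq> set G"
proof -
  define A where "A = filter (\<lambda>x. x \<in> H) G"
  have setA: "set A = H \<inter> S"
    unfolding A_def using H(2) S(2) by auto
  have "distinct A"
    unfolding A_def using G by simp
  then have lenA: "length A + 2 = k"
    using H(1) setA k unfolding cosecant_def by (simp add: distinct_card[symmetric])
  have A: "filter (\<lambda>x. x \<in> set A) G = A"
    unfolding A_def by (intro filter_cong) auto
  have AG: "set A \<subseteq> set G"
    unfolding A_def by auto
  have card_G: "k \<le> card (set G)"
    using G t by (simp add: distinct_card)
  have arcG: "arc k (set G)"
    using S(1,2) unfolding arc_def by blast
  obtain \<alpha> \<beta> where \<alpha>\<beta>: "\<alpha> \<in> carrier_vec k" "\<beta> \<in> carrier_vec k"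
    and dets: "\<And>u v. u \<in> carrier_vec k \<Longrightarrow> v \<in> carrier_vec k \<Longrightarrow>
       det_rows k (u # v # A) = cross (u \<bullet> \<alpha>, u \<bullet> \<beta>) (v \<bullet> \<alpha>, v \<bullet> \<beta>)"
    and kernel: "\<And>u. u \<in> carrier_vec k \<Longrightarrow> u \<bullet> \<alpha> = 0 \<Longrightarrow> u \<bullet> \<beta> = 0 \<Longrightarrow>
       u \<in> LinearCombinations.module.span class_ring (module_vec TYPE('a) k) (set A)"
    using arc_pair_coordinates[OF G A lenA arcG card_G] by metis
  have hyp: "hyperplane k H"
    using H(1) unfolding cosecant_def by blast
  have "set A \<subseteq> H"
    using setA by blast
  obtain w where w: "w \<in> carrier_vec k" "(w \<bullet> \<alpha>, w \<bullet> \<beta>) \<noteq> (0, 0)"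
    "\<And>s. s \<in> carrier_vec k \<Longrightarrow> s \<in> H \<longleftrightarrow> cross (s \<bullet> \<alpha>, s \<bullet> \<beta>) (w \<bullet> \<alpha>, w \<bullet> \<beta>) = 0"
    using hyperplane_direction[OF hyp \<open>set A \<subseteq> H\<close> lenA \<alpha>\<beta> dets kernel] by blast
  interpret S: arc_above k t G A \<alpha> \<beta> S
    using G A lenA S card_G dets by unfold_locales
  interpret S': arc_above k t G A \<alpha> \<beta> S'
    using G A lenA S' card_G dets by unfold_locales
  let ?I = "{1..length G - n - k + 1}"
  have "A \<in> set (sublists_of_size (k - 2) G)"
    using A lenA unfolding mem_sublists_of_size_iff[OF G] by auto
  from W[unfolded property_W_def, rule_format, OF this]
  obtain C Cs where CCs: "C \<in> set (M_rows k G) \<and> set A \<subseteq> set C \<and>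
      (\<forall>i\<in>?I. Cs i \<in> set (M_rows k G) \<and> set A \<subseteq> set (Cs i) \<and> Cs i \<noteq> C) \<and> inj_on Cs ?I \<and>
      (\<forall>i\<in>?I. \<exists>w\<in>M_column_space k G n. M_support k G w = {C, Cs i})"
    unfolding Let_def by (elim exE)
  then have C: "C \<in> set (M_rows k G)"
    and Cs: "\<And>i. i \<in> ?I \<Longrightarrow> Cs i \<in> set (M_rows k G)" "\<And>i. i \<in> ?I \<Longrightarrow> set A \<subseteq> set (Cs i)"
      "\<And>i. i \<in> ?I \<Longrightarrow> Cs i \<noteq> C" "inj_on Cs ?I"
      "\<And>i. i \<in> ?I \<Longrightarrow> \<exists>w\<in>M_column_space k G n. M_support k G w = {C, Cs i}"
    by simp_all
  have nz: "row_weight k S D \<noteq> 0" "row_weight k S' D \<noteq> 0" "row_weight k (set G) D \<noteq> 0"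
    if D: "D \<in> set (M_rows k G)" for D
    using row_weight_nonzero[of k _ D] rowsD[OF G D] k S S' arcG S.fin S'.fin by auto
  define \<gamma> where "\<gamma> = row_weight k S C / row_weight k S' C"
  have ratio: "row_weight k S (Cs i) = \<gamma> * row_weight k S' (Cs i)" if i: "i \<in> ?I" for i
  proof -
    let ?b = "\<lambda>S C. 1 / (row_weight k S C * row_weight k (set G) C)"
    obtain w where "w \<in> M_column_space k G n" "M_support k G w = {C, Cs i}"
      using Cs(5)[OF i] by blast
    then have "?b S C * ?b S' (Cs i) = ?b S' C * ?b S (Cs i)"
      using Cs(3)[OF i] left_kernel[OF k G t S] left_kernel[OF k G t S']
      by (intro left_kernel_two_point_support[OF G, of w k n C "Cs i"]) auto
    then show ?thesis
      using nz[OF C] nz[OF Cs(1)[OF i]] unfolding \<gamma>_def by (simp add: field_simps)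
  qed
  \<comment> \<open>The points whose rows are the \<open>Cs i\<close>. There are
    \<open>t + 1\<close> of them, one more than the degree of the tangent function.\<close>
  define Z where "Z = {e \<in> set G - set A. add_point G A e \<in> Cs ` ?I}"
  have "add_point G A ` Z = Cs ` ?I"
  proof
    show "Cs ` ?I \<subseteq> add_point G A ` Z"
    proof
      fix D assume D: "D \<in> Cs ` ?I"
      then obtain e where "e \<in> set G - set A" "D = add_point G A e"
        using rows_above_eq_add_point[OF G A lenA, of D] Cs(1,2) by (elim imageE) metis
      then show "D \<in> add_point G A ` Z"
        using D unfolding Z_def by simp
    qed
  qed (auto simp: Z_def)
  moreover have "inj_on (add_point G A) Z"
    by (rule inj_on_subset[OF inj_on_add_point[OF A]]) (auto simp: Z_def)
  ultimately have "card Z = card (Cs ` ?I)"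
    using card_image by fastforce
  then have "card Z = t + 1"
    using card_image[OF Cs(4)] t by simp
  have ZS: "Z \<subseteq> S - set A" "Z \<subseteq> S' - set A"
    unfolding Z_def using S(2) S'(2) by auto
  have "cross s' (S.coords w) \<noteq> 0" if s': "s' \<in> S'.points" for s'
  proof (rule tangents_determined[OF S.general_position_points S.finite_points S.card_points
        S'.general_position_points S'.finite_points S'.card_points, of "S.coords ` Z" \<gamma>])
    show "S.coords ` Z \<subseteq> S.points" "S.coords ` Z \<subseteq> S'.points"
      unfolding S.points_def S'.points_def by (intro image_mono ZS)+
    show "card (S.coords ` Z) = t + 1"
      using card_image[OF inj_on_subset[OF S.inj_coords ZS(1)]] \<open>card Z = t + 1\<close> by simp
    show "S.coords w \<noteq> (0, 0)"
      using w(2) unfolding S.coords_def .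
    \<comment> \<open>\<open>H\<close> meets \<open>S\<close> only in \<open>A\<close>, so no point
      of \<open>S - set A\<close> gives the point of \<open>w\<close>.\<close>
    show "cross s (S.coords w) \<noteq> 0" if "s \<in> S.points" for s
    proof -
      obtain u where "u \<in> S - set A" "s = S.coords u"
        using \<open>s \<in> S.points\<close> unfolding S.points_def by (elim imageE) metis
      then show ?thesis
        using w(3)[of u] S.carr setA unfolding S.coords_def by blast
    qed
    fix y assume "y \<in> S.coords ` Z"
    then obtain e where "e \<in> Z" "y = S.coords e"
      by (elim imageE) metis
    then obtain i where e: "e \<in> set G - set A" "y = S.coords e" "i \<in> ?I" "add_point G A e = Cs i"
      unfolding Z_def by auto
    obtain \<sigma> where \<sigma>: "\<sigma> * \<sigma> = 1" "\<And>u. det_rows k (u # add_point G A e) = \<sigma> * det_rows k (u # e # A)"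
      using det_rows_add_point[OF G A lenA e(1)] by blast
    \<comment> \<open>Arcs of equal size give \<open>\<sigma>\<close> the same exponent in both
      weights, so it cancels.\<close>
    have "\<sigma> \<noteq> 0" "card S = card S'"
      using \<sigma>(1) S(3) S'(3) by auto
    then show "(\<Prod>u\<in>S.points - {y}. cross u y) = \<gamma> * (\<Prod>u\<in>S'.points - {y}. cross u y)"
      using ratio[OF e(3)] S.row_weight_add_point[OF e(1) \<sigma>(2)] S'.row_weight_add_point[OF e(1) \<sigma>(2)]
      unfolding e(4)[symmetric] e(2) by simp
  qed (rule s')
  then have "s \<notin> H" if "s \<in> S' - set A" for s
    using w(3)[of s] that S'.carr unfolding S'.points_def S'.coords_def S.coords_def by blast
  moreover have "set A \<subseteq> S'"
    using AG S'(2) by blast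
  ultimately have "H \<inter> S' = H \<inter> S"
    using setA by blast
  then show ?thesis
    using H unfolding cosecant_def by simp
qed

theorem theorem1p2:
  fixes G :: "'a::{field,finite} vec list" and q k n :: nat and S S' :: "'a vec set"
  assumes "q = card (UNIV :: 'a set)"
    and "k \<ge> 3"
    and "distinct G" and "arc k (set G)"
    and "n + k \<le> card (set G)"
    and "property_W k G n"
    and "arc k S" and "set G \<subseteq> S"
    and "int (card S) = int q + 2 * int k + int n - 1 - int (card (set G))"
    and "arc k S'" and "set G \<subseteq> S'"
    and "int (card S') = int q + 2 * int k + int n - 1 - int (card (set G))"
  shows "{H. cosecant k S H \<and> H \<inter> S \<subseteq> set G} = {H. cosecant k S' H \<and> H \<inter> S' \<subseteq> set G}"
proof -
  define t where "t = length G - n - k"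
  have card_G: "card (set G) = length G"
    using assms(3) by (rule distinct_card)
  then have t: "length G = n + k + t"
    using assms(5) unfolding t_def by simp
  \<comment> \<open>In terms of \<open>t\<close> the prescribed size is
    \<open>q + k - 1 - t\<close>, written here without subtraction.\<close>
  have S: "card S + t + 1 = card (UNIV :: 'a set) + k"
    and S': "card S' + t + 1 = card (UNIV :: 'a set) + k"
    using assms(1,9,12) card_G t by linarith+
  have k: "k \<ge> 2"
    using assms(2) by simp
  show ?thesis
    using cosecant_in_transfer[OF k assms(3) t assms(6) assms(7,8) S assms(10,11) S']
      cosecant_in_transfer[OF k assms(3) t assms(6) assms(10,11) S' assms(7,8) S]
    by (intro Collect_cong iffI; elim conjE; blast)
qed

end
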